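(* Let $A$ be a scalar type spectral operator in a complex Banach space $(X,\|\cdot\|)$. If every weak solution of the evolution equation $y'(t)=Ay(t)$, $t\ge0$, is analytically continuable into a complex neighborhood of $0$ (each one into its own), then all weak solutions of this equation are entire vector functions.
   Context: **Scalar type spectral operator (in the sense of Dunford).** A closed densely defined linear operator $A$ (possibly unbounded) in a complex Banach space $X$ for which there is a strongly $\sigma$-additive spectral measure $E_A(\cdot)$ (resolution of the identity) assigning to each Borel set $\delta\subseteq\mathbb{C}$ a bounded projection operator $E_A(\delta)$ on $X$, with $E_A(\emptyset)=0$, $E_A(\mathbb{C})=I$, $E_A(\delta)E_A(\sigma)=E_A(\delta\cap\sigma)$, having the spectrum $\sigma(A)$ as its support, and such that $A=\int_{\sigma(A)}\lambda\,dE_A(\lambda)$, i.e., $Af=\lim_{n\to\infty}\int_{\{\lambda\in\sigma(A):|\lambda|\le n\}}\lambda\,dE_A(\lambda)f$ with $D(A)$ being the set of all $f\in X$ for which this limit exists. $A$ is not assumed to generate a $C_0$-semigroup. **Weak solution.** A strongly continuous function $y:[0,\infty)\to X$ is a weak solution of $y'(t)=Ay(t)$, $t\ge0$, if for every $g^*\in D(A^* )$, $$\frac{d}{dt}\langle y(t),g^*\rangle=\langle y(t),A^*g^*\rangle,\quad t\ge 0,$$ where $A^*$ is the adjoint of $A$ and $\langle\cdot,\cdot\rangle$ is the pairing between $X$ and its dual $X^*$. Equivalently, for all $t\ge0$, $\int_0^t y(s)\,ds\in D(A)$ and $y(t)=y(0)+A\int_0^t y(s)\,ds$. **Analytic continuability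 at $0$.** A function $y:[0,\infty)\to X$ is analytically continuable into a complex neighborhood of $0$ if there are a $\delta>0$ and an analytic $X$-valued function on the disk $\{z\in\mathbb{C}:|z|<\delta\}$ coinciding with $y$ on $[0,\delta)$; the neighborhood may depend on $y$. **Entire vector function.** A function $y:[0,\infty)\to X$ is called entire if it allows an entire continuation, i.e., it is the restriction to $[0,\infty)$ of an entire (analytic on all of $\mathbb{C}$) $X$-valued function. *)

theory Defs
  imports "HOL-Analysis.Analysis"
begin

class complex_normed_vector = real_normed_vector +
  fixes scaleC :: "complex \<Rightarrow> 'a \<Rightarrow> 'a"  (infixr "*\<^sub>C" 75)
  assumes scaleC_add_right: "c *\<^sub>C (x + y) = c *\<^sub>C x + c *\<^sub>C y"
    and scaleC_add_left: "(c + d) *\<^sub>C x = c *\<^sub>C x + d *\<^sub>C x"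
    and scaleC_scaleC: "c *\<^sub>C (d *\<^sub>C x) = (c * d) *\<^sub>C x"
    and scaleC_of_real: "complex_of_real r *\<^sub>C x = r *\<^sub>R x"
    and norm_scaleC: "norm (c *\<^sub>C x) = cmod c * norm x"

class complex_banach = complex_normed_vector + banach

instantiation complex :: complex_banach
begin

definition scaleC_complex :: "complex \<Rightarrow> complex \<Rightarrow> complex"
  where "scaleC_complex c x = c * x"

instance
  by standard (simp_all add: scaleC_complex_def algebra_simps norm_mult scaleR_conv_of_real)

end

definition bounded_clinear ::
    "('a::complex_normed_vector \<Rightarrow> 'b::complex_normed_vector) \<Rightarrow> bool"
  where "bounded_clinear T \<longleftrightarrow> bounded_linear T \<and> (\<forall>c x. T (c *\<^sub>C x) = c *\<^sub>C T x)"

text \<open>An operator is given by its domain \<open>D\<close> together with a function \<open>A\<close>, whose values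
  outside \<open>D\<close> are irrelevant.\<close>

definition clinear_operator ::
    "'a::complex_normed_vector set \<Rightarrow> ('a \<Rightarrow> 'a) \<Rightarrow> bool"
  where "clinear_operator D A \<longleftrightarrow>
    0 \<in> D \<and>
    (\<forall>f\<in>D. \<forall>g\<in>D. f + g \<in> D \<and> A (f + g) = A f + A g) \<and>
    (\<forall>c. \<forall>f\<in>D. c *\<^sub>C f \<in> D \<and> A (c *\<^sub>C f) = c *\<^sub>C A f)"

definition closed_operator ::
    "'a::complex_normed_vector set \<Rightarrow> ('a \<Rightarrow> 'a) \<Rightarrow> bool"
  where "closed_operator D A \<longleftrightarrow> closed {(f, A f) | f. f \<in> D}"

definition resolvent_set ::
    "'a::complex_normed_vector set \<Rightarrow> ('a \<Rightarrow> 'a) \<Rightarrow> complex set"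
  where "resolvent_set D A =
    {z. bij_betw (\<lambda>f. A f - z *\<^sub>C f) D UNIV \<and>
        bounded_clinear (inv_into D (\<lambda>f. A f - z *\<^sub>C f))}"

definition op_spectrum ::
    "'a::complex_normed_vector set \<Rightarrow> ('a \<Rightarrow> 'a) \<Rightarrow> complex set"
  where "op_spectrum D A = - resolvent_set D A"

text \<open>The dual space consists of the functionals \<open>g :: 'a \<Rightarrow> complex\<close> with
  \<open>bounded_clinear g\<close>; the pairing of \<open>f\<close> and \<open>g\<close> is \<open>g f\<close>.\<close>

definition adjoint_domain ::
    "'a::complex_normed_vector set \<Rightarrow> ('a \<Rightarrow> 'a) \<Rightarrow> ('a \<Rightarrow> complex) set"
  where "adjoint_domain D A =
    {g. bounded_clinear g \<and> (\<exists>h. bounded_clinear h \<and> (\<forall>f\<in>D. g (A f) = h f))}"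

text \<open>The functional below is unique when \<open>D\<close> is dense.\<close>

definition op_adjoint ::
    "'a::complex_normed_vector set \<Rightarrow> ('a \<Rightarrow> 'a) \<Rightarrow> ('a \<Rightarrow> complex) \<Rightarrow> ('a \<Rightarrow> complex)"
  where "op_adjoint D A g = (THE h. bounded_clinear h \<and> (\<forall>f\<in>D. g (A f) = h f))"

text \<open>Only the values of \<open>E\<close> on Borel sets are constrained.\<close>

definition spectral_measure ::
    "(complex set \<Rightarrow> 'a::complex_normed_vector \<Rightarrow> 'a) \<Rightarrow> bool"
  where "spectral_measure E \<longleftrightarrow>
    (\<forall>S\<in>sets borel. bounded_clinear (E S)) \<and>
    E {} = (\<lambda>x. 0) \<and>
    E UNIV = (\<lambda>x. x) \<and>
    (\<forall>S\<in>sets borel. \<forall>T\<in>sets borel. E S \<circ> E T = E (S \<inter> T)) \<and>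
    (\<forall>F :: nat \<Rightarrow> complex set. range F \<subseteq> sets borel \<longrightarrow> disjoint_family F \<longrightarrow>
       (\<forall>x. (\<lambda>n. E (F n) x) sums E (\<Union>n. F n) x))"

text \<open>The complement of the support is the largest open set on which \<open>E\<close> vanishes: by
  the Lindelof property and \<open>\<sigma>\<close>-additivity, a union of open null sets is a null set.\<close>

definition spectral_support ::
    "(complex set \<Rightarrow> 'a::complex_normed_vector \<Rightarrow> 'a) \<Rightarrow> complex set"
  where "spectral_support E = {z. \<forall>U. open U \<longrightarrow> z \<in> U \<longrightarrow> E U \<noteq> (\<lambda>x. 0)}"

definition simple_spectral_integral ::
    "(complex set \<Rightarrow> 'a::complex_normed_vector \<Rightarrow> 'a) \<Rightarrow> (complex \<Rightarrow> complex) \<Rightarrow> 'a \<Rightarrow> 'a"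
  where "simple_spectral_integral E s x = (\<Sum>c\<in>range s. c *\<^sub>C E (s -` {c}) x)"

text \<open>The integral of a bounded Borel function \<open>\<phi>\<close> is the limit in the operator norm of the
  integrals of simple functions converging uniformly to \<open>\<phi>\<close>.\<close>

definition has_spectral_integral ::
    "(complex set \<Rightarrow> 'a::complex_normed_vector \<Rightarrow> 'a) \<Rightarrow> (complex \<Rightarrow> complex) \<Rightarrow> ('a \<Rightarrow> 'a) \<Rightarrow> bool"
  where "has_spectral_integral E \<phi> T \<longleftrightarrow>
    bounded_clinear T \<and>
    (\<exists>s. (\<forall>n. simple_function borel (s n)) \<and> uniform_limit UNIV s \<phi> sequentially \<and>
         (\<lambda>n. onorm (\<lambda>x. simple_spectral_integral E (s n) x - T x)) \<longlonglongrightarrow> 0)"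

definition spectral_integral ::
    "(complex set \<Rightarrow> 'a::complex_normed_vector \<Rightarrow> 'a) \<Rightarrow> (complex \<Rightarrow> complex) \<Rightarrow> 'a \<Rightarrow> 'a"
  where "spectral_integral E \<phi> = (THE T. has_spectral_integral E \<phi> T)"

definition truncated_spectral_integral ::
    "(complex set \<Rightarrow> 'a::complex_normed_vector \<Rightarrow> 'a) \<Rightarrow> complex set \<Rightarrow> nat \<Rightarrow> 'a \<Rightarrow> 'a"
  where "truncated_spectral_integral E S n =
    spectral_integral E (\<lambda>z. if z \<in> S \<and> cmod z \<le> real n then z else 0)"

definition scalar_type_spectral_operator ::
    "'a::complex_normed_vector set \<Rightarrow> ('a \<Rightarrow> 'a) \<Rightarrow> bool"
  where "scalar_type_spectral_operator D A \<longleftrightarrow>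
    clinear_operator D A \<and> closed_operator D A \<and> closure D = UNIV \<and>
    (\<exists>E. spectral_measure E \<and>
         spectral_support E = op_spectrum D A \<and>
         D = {f. convergent (\<lambda>n. truncated_spectral_integral E (op_spectrum D A) n f)} \<and>
         (\<forall>f\<in>D. (\<lambda>n. truncated_spectral_integral E (op_spectrum D A) n f) \<longlonglongrightarrow> A f))"

text \<open>A function on \<open>[0, \<infinity>)\<close> is a function on the reals of which only the restriction to
  \<open>{0..}\<close> matters; the derivative at \<open>0\<close> is one-sided.\<close>

definition weak_solution ::
    "'a::complex_normed_vector set \<Rightarrow> ('a \<Rightarrow> 'a) \<Rightarrow> (real \<Rightarrow> 'a) \<Rightarrow> bool"
  where "weak_solution D A y \<longleftrightarrow>
    continuous_on {0..} y \<and>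
    (\<forall>g\<in>adjoint_domain D A. \<forall>t\<ge>0.
       ((\<lambda>s. g (y s)) has_vector_derivative op_adjoint D A g (y t)) (at t within {0..}))"

definition vector_analytic_on ::
    "(complex \<Rightarrow> 'a::complex_normed_vector) \<Rightarrow> complex set \<Rightarrow> bool"
  where "vector_analytic_on Y U \<longleftrightarrow>
    open U \<and> (\<forall>z\<in>U. \<exists>d. (Y has_derivative (\<lambda>h. h *\<^sub>C d)) (at z))"

definition analytically_continuable_at_0 ::
    "(real \<Rightarrow> 'a::complex_normed_vector) \<Rightarrow> bool"
  where "analytically_continuable_at_0 y \<longleftrightarrow>
    (\<exists>\<delta>>0. \<exists>Y. vector_analytic_on Y (ball 0 \<delta>) \<and>
        (\<forall>t\<in>{0..<\<delta>}. Y (complex_of_real t) = y t))"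

definition entire_vector_function ::
    "(real \<Rightarrow> 'a::complex_normed_vector) \<Rightarrow> bool"
  where "entire_vector_function y \<longleftrightarrow>
    (\<exists>Y. vector_analytic_on Y UNIV \<and> (\<forall>t\<ge>0. Y (complex_of_real t) = y t))"

end

theory Submission
  imports Defs "HOL-Complex_Analysis.Complex_Analysis"
begin

text \<open>Weak solutions are orbits \<open>exp (t A) f\<close> of an operator exponential given by the functional calculus of
  the spectral measure, so questions about them become questions about the growth of the scalar
  functions \<open>l \<mapsto> exp (z l)\<close> on the spectrum.  Both halves of the argument go through one condition:
  there is a constant \<open>C\<close> with \<open>\<bar>l\<bar> \<le> C (1 + max 0 (Re l))\<close> for all \<open>l\<close> in the spectrum.

  If the condition holds and \<open>y\<close> is a weak solution, then for \<open>\<bar>z\<bar> \<le> r\<close> and \<open>t\<close> large compared with \<open>r\<close>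
  the function \<open>l \<mapsto> exp ((z - t) l)\<close> is bounded on the spectrum.  Hence \<open>exp ((z - t) A) y(t)\<close> makes
  sense, is analytic in \<open>z\<close> on the disk of radius \<open>r\<close>, and agrees with \<open>y\<close> at the points of \<open>[0, r)\<close>.
  As \<open>r\<close> is arbitrary, \<open>y\<close> is entire (\<open>entire_of_spectral_growth\<close>).

  If the condition fails, there are points \<open>\<mu>\<^sub>n\<close> of the spectrum, far apart from each other, with
  \<open>\<bar>\<mu>\<^sub>n\<bar> > n\<^sup>2 a\<^sub>n\<close> where \<open>a\<^sub>n = 1 + max 0 (Re \<mu>\<^sub>n)\<close>.  Choose unit vectors \<open>e\<^sub>n\<close> in the spectral subspaces of
  the unit disks around \<open>\<mu>\<^sub>n\<close>.  The orbit of the vector \<open>\<Sum>n. exp (- n a\<^sub>n) e\<^sub>n\<close> exists for all positive times,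
  because \<open>exp (t A)\<close> magnifies \<open>e\<^sub>n\<close> by at most a constant times \<open>exp (t a\<^sub>n)\<close>; it is a weak solution.  An
  analytic continuation to a disk around \<open>0\<close> would have the \<open>n\<close>-th component \<open>exp (- n a\<^sub>n) exp (z A) e\<^sub>n\<close>, and
  for \<open>z\<close> of modulus \<open>r\<close> pointing in the direction of the conjugate of \<open>\<mu>\<^sub>n\<close> this has norm at least of
  order \<open>exp (r \<bar>\<mu>\<^sub>n\<bar> - n a\<^sub>n)\<close>, which is unbounded (\<open>exists_noncontinuable_weak_solution\<close>).

  Three tools carry this.  The functional calculus for bounded Borel functions is linear,
  multiplicative and bounded in the supremum norm; the bound rests on the uniform boundedness of a
  countably additive family of projections.  Analyticity comes from the second order Taylor
  estimate for the exponential function, transported by this bound (\<open>calc_exp_remainder\<close>).  As weak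
  solutions are defined by testing with functionals, functionals must separate points; this
  is the Hahn-Banach theorem, proved here through minimal sublinear functionals.\<close>

section \<open>Uniform boundedness and separation by functionals\<close>

text \<open>The closed sets on which the family is bounded by \<open>n\<close> exhaust the space, so by Baire's theorem one
  of them contains a ball.\<close>

lemma uniform_boundedness:
  fixes T :: "'i \<Rightarrow> 'a::banach \<Rightarrow> 'b::real_normed_vector"
  assumes lin: "\<And>i. i \<in> I \<Longrightarrow> bounded_linear (T i)"
    and pt: "\<And>x. \<exists>B. \<forall>i\<in>I. norm (T i x) \<le> B"
  shows "\<exists>M\<ge>0. \<forall>i\<in>I. \<forall>x. norm (T i x) \<le> M * norm x"
proof -
  define F where "F n = {x. \<forall>i\<in>I. norm (T i x) \<le> real n}" for n :: nat
  have cl: "closed (F n)" for n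
  proof -
    have "F n = (\<Inter>i\<in>I. {x. norm (T i x) \<le> real n})" by (auto simp: F_def)
    moreover have "closed {x. norm (T i x) \<le> real n}" if "i \<in> I" for i
      by (intro closed_Collect_le continuous_intros
            bounded_linear.continuous_on[OF lin[OF that]])
    ultimately show ?thesis by auto
  qed
  have un: "(\<Union>n. F n) = UNIV"
  proof -
    have "\<exists>n. x \<in> F n" for x
    proof -
      obtain B where B: "\<forall>i\<in>I. norm (T i x) \<le> B" using pt by blast
      obtain n :: nat where "B \<le> real n" using real_arch_simple by blast
      then have "x \<in> F n" using B by (force simp: F_def)
      then show ?thesis ..
    qed
    then show ?thesis by auto
  qed
  have "\<exists>n. interior (F n) \<noteq> {}"
  proof (rule ccontr)
    assume "\<not> ?thesis"
    then have "euclidean interior_of (\<Union>(range F)) = ({} :: 'a set)"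
      using cl by (intro Baire_category_alt) (auto simp: completely_metrizable_space_euclidean)
    then show False using un by simp
  qed
  then obtain n x0 where "x0 \<in> interior (F n)" by blast
  then obtain r where r: "r > 0" "cball x0 r \<subseteq> F n"
    using mem_interior_cball by blast
  have "norm (T i x) \<le> (2 * real n / r) * norm x" if i: "i \<in> I" for i x
  proof (cases "x = 0")
    case True
    then show ?thesis using linear_0[OF bounded_linear.linear[OF lin[OF i]]] by simp
  next
    case False
    interpret bounded_linear "T i" by (rule lin[OF i])
    define c where "c = r / norm x"
    have c: "c > 0" using False r by (simp add: c_def)
    have "x0 + c *\<^sub>R x \<in> cball x0 r" using False r by (simp add: c_def dist_norm)
    then have 1: "norm (T i (x0 + c *\<^sub>R x)) \<le> real n" using r i by (auto simp: F_def)
    have "x0 \<in> F n" using r by auto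
    then have 2: "norm (T i x0) \<le> real n" using i by (simp add: F_def)
    have "c * norm (T i x) = norm (T i (x0 + c *\<^sub>R x) - T i x0)"
      using c by (simp add: add scaleR)
    also have "\<dots> \<le> 2 * real n" using norm_triangle_ineq4[of "T i (x0 + c *\<^sub>R x)" "T i x0"] 1 2 by linarith
    finally show ?thesis using c False r by (simp add: c_def field_simps)
  qed
  then show ?thesis using r by (intro exI[of _ "2 * real n / r"]) auto
qed

definition sublinear :: "('a::real_vector \<Rightarrow> real) \<Rightarrow> bool" where
  "sublinear q \<longleftrightarrow> (\<forall>x y. q (x + y) \<le> q x + q y) \<and> (\<forall>c>0. \<forall>x. q (c *\<^sub>R x) \<le> c * q x)"

lemma sublinear_add: "sublinear q \<Longrightarrow> q (x + y) \<le> q x + q y"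
  and sublinear_scale_le: "sublinear q \<Longrightarrow> c > 0 \<Longrightarrow> q (c *\<^sub>R x) \<le> c * q x"
  by (auto simp: sublinear_def)

lemma sublinear_0: assumes "sublinear q" shows "q 0 = 0"
  using sublinear_add[OF assms, of 0 0] sublinear_scale_le[OF assms, of "1/2" 0] by simp

lemma sublinear_minus: assumes "sublinear q" shows "- q (- x) \<le> q x"
  using sublinear_add[OF assms, of x "- x"] sublinear_0[OF assms] by simp

lemma sublinear_scale: assumes "sublinear q" "c \<ge> 0" shows "q (c *\<^sub>R x) = c * q x"
proof (cases "c = 0")
  case True then show ?thesis using sublinear_0[OF assms(1)] by simp
next
  case False
  then have c: "c > 0" using assms by simp
  have "q ((1/c) *\<^sub>R (c *\<^sub>R x)) \<le> (1/c) * q (c *\<^sub>R x)"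
    by (rule sublinear_scale_le) (use assms c in auto)
  then have "c * q x \<le> q (c *\<^sub>R x)" using c by (simp add: field_simps)
  then show ?thesis using sublinear_scale_le[OF assms(1) c, of x] by simp
qed

text \<open>Moving along the ray in direction \<open>y\<close> pushes a sublinear functional down until it is
  additive in that direction.\<close>

lemma sublinear_lower_along:
  assumes q: "sublinear q"
  obtains q' where "sublinear q'" "\<And>x. q' x \<le> q x" "\<And>x. q' x \<le> q (x + y) - q y"
proof -
  define q' where "q' x = (INF t\<in>{0..}. q (x + t *\<^sub>R y) - t * q y)" for x
  have lb: "- q (- x) \<le> q (x + t *\<^sub>R y) - t * q y" if "t \<ge> 0" for x t
  proof -
    have "t * q y = q (t *\<^sub>R y)" using sublinear_scale[OF q that] by simp
    also have "\<dots> \<le> q (x + t *\<^sub>R y) + q (- x)"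
      using sublinear_add[OF q, of "x + t *\<^sub>R y" "- x"] by simp
    finally show ?thesis by simp
  qed
  have bd: "bdd_below ((\<lambda>t. q (x + t *\<^sub>R y) - t * q y) ` {0..})" for x
    using lb by (intro bdd_belowI2[of _ "- q (- x)"]) auto
  have le: "q' x \<le> q (x + t *\<^sub>R y) - t * q y" if "t \<ge> 0" for x t
    unfolding q'_def using that by (intro cINF_lower[OF bd]) auto
  have gr: "m \<le> q' x" if "\<And>t. t \<ge> 0 \<Longrightarrow> m \<le> q (x + t *\<^sub>R y) - t * q y" for x m
    unfolding q'_def using that by (intro cINF_greatest) auto
  have "sublinear q'"
    unfolding sublinear_def
  proof (intro conjI allI impI)
    fix x z
    have "q' (x + z) - (q (x + t *\<^sub>R y) - t * q y) \<le> q (z + s *\<^sub>R y) - s * q y"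
      if "t \<ge> 0" "s \<ge> 0" for s t
    proof -
      have "q' (x + z) \<le> q ((x + z) + (t + s) *\<^sub>R y) - (t + s) * q y" using that by (intro le) auto
      also have "(x + z) + (t + s) *\<^sub>R y = (x + t *\<^sub>R y) + (z + s *\<^sub>R y)" by (simp add: algebra_simps)
      also have "q \<dots> \<le> q (x + t *\<^sub>R y) + q (z + s *\<^sub>R y)" by (rule sublinear_add[OF q])
      finally show ?thesis by (simp add: algebra_simps)
    qed
    then have "q' (x + z) - (q (x + t *\<^sub>R y) - t * q y) \<le> q' z" if "t \<ge> 0" for t
      using that by (intro gr) auto
    then have "q' (x + z) - q' z \<le> q (x + t *\<^sub>R y) - t * q y" if "t \<ge> 0" for t
      using that by (simp add: algebra_simps)
    then have "q' (x + z) - q' z \<le> q' x" by (intro gr) auto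
    then show "q' (x + z) \<le> q' x + q' z" by simp
  next
    fix c :: real and x assume c: "c > 0"
    have "q' (c *\<^sub>R x) / c \<le> q' x"
    proof (rule gr)
      fix t :: real assume t: "t \<ge> 0"
      have "q' (c *\<^sub>R x) \<le> q (c *\<^sub>R x + (c * t) *\<^sub>R y) - (c * t) * q y" using c t by (intro le) auto
      also have "c *\<^sub>R x + (c * t) *\<^sub>R y = c *\<^sub>R (x + t *\<^sub>R y)" by (simp add: algebra_simps)
      also have "q \<dots> = c * q (x + t *\<^sub>R y)" using c by (intro sublinear_scale q) auto
      finally show "q' (c *\<^sub>R x) / c \<le> q (x + t *\<^sub>R y) - t * q y" using c by (simp add: field_simps)
    qed
    then show "q' (c *\<^sub>R x) \<le> c * q' x" using c by (simp add: field_simps)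
  qed
  moreover have "q' x \<le> q x" for x using le[of 0 x] by simp
  moreover have "q' x \<le> q (x + y) - q y" for x using le[of 1 x] by simp
  ultimately show ?thesis using that by blast
qed

text \<open>By Zorn's lemma there is a minimal sublinear functional below \<open>p\<close>.  Lowering it along any direction
  changes nothing, so it is additive in every direction.\<close>

lemma linear_below_sublinear:
  assumes p: "sublinear p"
  obtains u where "linear u" "\<And>x. u x \<le> p x"
proof -
  define Q where "Q = {q. sublinear q \<and> (\<forall>x. q x \<le> p x)}"
  have "\<exists>m\<in>Q. \<forall>a\<in>Q. m \<ge> a \<longrightarrow> a = m"
  proof (rule predicate_Zorn[where P = "\<lambda>q r. q \<ge> r"])
    show "partial_order_on Q (relation_of (\<lambda>q r. q \<ge> r) Q)"
      by (rule partial_order_on_relation_ofI) auto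
  next
    fix C assume C: "C \<in> Chains (relation_of (\<lambda>q r. q \<ge> r) Q)"
    have CQ: "q \<in> Q" if "q \<in> C" for q
      using C that by (auto simp: Chains_def relation_of_def)
    have tot: "q \<le> r \<or> r \<le> q" if "q \<in> C" "r \<in> C" for q r
      using C that by (auto simp: Chains_def relation_of_def)
    show "\<exists>u\<in>Q. \<forall>a\<in>C. a \<ge> u"
    proof (cases "C = {}")
      case True
      then show ?thesis using p by (auto simp: Q_def)
    next
      case False
      define r where "r x = (INF q\<in>C. q x)" for x
      have bd: "bdd_below ((\<lambda>q. q x) ` C)" for x
      proof (rule bdd_belowI2)
        fix q assume "q \<in> C"
        then have q: "sublinear q" "q (- x) \<le> p (- x)" using CQ by (auto simp: Q_def)
        show "- p (- x) \<le> q x" using sublinear_minus[OF q(1), of x] q(2) by simp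
      qed
      have le: "r x \<le> q x" if "q \<in> C" for q x unfolding r_def by (rule cINF_lower[OF bd that])
      have gr: "m \<le> r x" if "\<And>q. q \<in> C \<Longrightarrow> m \<le> q x" for m x
        unfolding r_def using False that by (intro cINF_greatest) auto
      have "sublinear r" unfolding sublinear_def
      proof (intro conjI allI impI)
        fix x y
        have *: "r (x + y) \<le> q1 x + q2 y" if qq: "q1 \<in> C" "q2 \<in> C" for q1 q2
        proof -
          obtain q where q: "q \<in> C" "q \<le> q1" "q \<le> q2" using tot[OF qq] qq by blast
          have "r (x + y) \<le> q (x + y)" by (rule le[OF q(1)])
          also have "\<dots> \<le> q x + q y" using CQ[OF q(1)] by (auto simp: Q_def sublinear_add)
          finally show ?thesis using le_funD[OF q(2), of x] le_funD[OF q(3), of y] by linarith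
        qed
        have "r (x + y) - q1 x \<le> r y" if "q1 \<in> C" for q1
          by (rule gr) (use *[OF that] in fastforce)
        then have "r (x + y) - r y \<le> r x" by (intro gr) fastforce
        then show "r (x + y) \<le> r x + r y" by simp
      next
        fix c :: real and x assume c: "c > 0"
        have "r (c *\<^sub>R x) / c \<le> r x"
        proof (rule gr)
          fix q assume q: "q \<in> C"
          have "r (c *\<^sub>R x) \<le> q (c *\<^sub>R x)" by (rule le[OF q])
          also have "\<dots> \<le> c * q x" using CQ[OF q] c by (auto simp: Q_def sublinear_scale_le)
          finally show "r (c *\<^sub>R x) / c \<le> q x" using c by (simp add: field_simps)
        qed
        then show "r (c *\<^sub>R x) \<le> c * r x" using c by (simp add: field_simps)
      qed
      moreover have "r x \<le> p x" for x
      proof -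
        obtain q where q: "q \<in> C" using False by blast
        show ?thesis using le[OF q, of x] CQ[OF q] by (auto simp: Q_def intro: order_trans)
      qed
      ultimately have "r \<in> Q" by (auto simp: Q_def)
      then show ?thesis using le by (intro bexI[of _ r]) (auto simp: le_fun_def)
    qed
  qed
  then obtain m where m: "m \<in> Q" and min: "\<And>a. a \<in> Q \<Longrightarrow> a \<le> m \<Longrightarrow> a = m" by blast
  have sm: "sublinear m" and mp: "\<And>x. m x \<le> p x" using m by (auto simp: Q_def)
  have add: "m (x + y) = m x + m y" for x y
  proof -
    obtain q' where q': "sublinear q'" "\<And>x. q' x \<le> m x" "\<And>x. q' x \<le> m (x + y) - m y"
      using sublinear_lower_along[OF sm] by blast
    have "q' \<in> Q" using q' mp order_trans by (fastforce simp: Q_def)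
    then have "q' = m" using q'(2) by (intro min) (auto simp: le_fun_def)
    then show ?thesis using q'(3)[of x] sublinear_add[OF sm, of x y] by simp
  qed
  have neg: "m (- x) = - m x" for x using add[of x "- x"] sublinear_0[OF sm] by simp
  have "m (c *\<^sub>R x) = c * m x" for c x
  proof (cases "c \<ge> 0")
    case True then show ?thesis by (rule sublinear_scale[OF sm])
  next
    case False
    then have "m ((- c) *\<^sub>R x) = (- c) * m x" by (intro sublinear_scale[OF sm]) auto
    then show ?thesis using neg[of "c *\<^sub>R x"] by simp
  qed
  then have "linear m" using add by (intro linearI) auto
  then show ?thesis using mp that by blast
qed

lemma bounded_clinear_bounded_linear: "bounded_clinear T \<Longrightarrow> bounded_linear T"
  and bounded_clinear_scaleC: "bounded_clinear T \<Longrightarrow> T (c *\<^sub>C x) = c *\<^sub>C T x"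
  by (auto simp: bounded_clinear_def)

text \<open>Lowering the norm along \<open>x0\<close> makes its value at \<open>- x0\<close> at most \<open>- norm x0\<close>; a real linear functional
  below it therefore does not vanish at \<open>x0\<close>.  A real functional \<open>u\<close> is the real part of the complex
  functional \<open>x \<mapsto> u x - i u (i x)\<close>.\<close>

lemma functional_nonzero_at:
  fixes x0 :: "'a::complex_normed_vector"
  assumes "x0 \<noteq> 0"
  obtains g :: "'a \<Rightarrow> complex" where "bounded_clinear g" "g x0 \<noteq> 0"
proof -
  have "sublinear (norm :: 'a \<Rightarrow> real)" by (auto simp: sublinear_def norm_triangle_ineq)
  then obtain p where p: "sublinear p" "\<And>x. p x \<le> norm x" "\<And>x. p x \<le> norm (x + x0) - norm x0"
    using sublinear_lower_along by blast
  obtain u where u: "linear u" "\<And>x. u x \<le> p x" using linear_below_sublinear[OF p(1)] by blast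
  interpret u: linear u by (rule u(1))
  have un: "\<bar>u x\<bar> \<le> norm x" for x
    using u(2)[of x] p(2)[of x] u(2)[of "- x"] p(2)[of "- x"] u.neg[of x] by simp
  have bu: "bounded_linear u"
    using un u.add u.scaleR by (intro bounded_linear_intro[where K = 1]) auto
  have "u (- x0) \<le> - norm x0" using u(2)[of "- x0"] p(3)[of "- x0"] by simp
  then have ux0: "u x0 \<noteq> 0" using assms u.neg[of x0] by auto
  define g where "g x = Complex (u x) (- u (\<i> *\<^sub>C x))" for x
  have iR: "\<i> *\<^sub>C (r *\<^sub>R x) = r *\<^sub>R (\<i> *\<^sub>C x)" for r and x :: 'a
    by (simp flip: scaleC_of_real add: scaleC_scaleC mult.commute)
  have "bounded_linear g"
  proof (rule bounded_linear_intro[where K = 2])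
    show "g (x + y) = g x + g y" for x y
      by (simp add: g_def complex_eq_iff scaleC_add_right u.add)
    show "g (r *\<^sub>R x) = r *\<^sub>R g x" for r x
      by (simp add: g_def complex_eq_iff iR u.scaleR)
    show "norm (g x) \<le> norm x * 2" for x
    proof -
      have "norm (g x) \<le> \<bar>u x\<bar> + \<bar>u (\<i> *\<^sub>C x)\<bar>" using cmod_le[of "g x"] by (simp add: g_def)
      also have "\<dots> \<le> norm x + norm (\<i> *\<^sub>C x)" by (intro add_mono un)
      finally show ?thesis by (simp add: norm_scaleC)
    qed
  qed
  moreover have "g (c *\<^sub>C x) = c *\<^sub>C g x" for c x
  proof -
    have d: "c *\<^sub>C x = Re c *\<^sub>R x + Im c *\<^sub>R (\<i> *\<^sub>C x)"
      by (simp flip: scaleC_of_real add: scaleC_scaleC mult.commute flip: scaleC_add_left complex_eq)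
    have "\<i> *\<^sub>C (\<i> *\<^sub>C x) = - x"
      using scaleC_of_real[of "- 1" x] by (simp add: scaleC_scaleC)
    then have di: "\<i> *\<^sub>C (c *\<^sub>C x) = Re c *\<^sub>R (\<i> *\<^sub>C x) + Im c *\<^sub>R (- x)"
      unfolding d by (simp add: scaleC_add_right iR)
    show ?thesis
      unfolding g_def di scaleC_complex_def unfolding d
      by (simp add: complex_eq_iff u.add u.scaleR u.neg u.diff)
  qed
  ultimately have "bounded_clinear g" by (simp add: bounded_clinear_def)
  moreover have "g x0 \<noteq> 0" using ux0 by (simp add: g_def complex_eq_iff)
  ultimately show ?thesis using that by blast
qed

lemma bounded_clinear_compose:
  assumes "bounded_clinear g" "bounded_clinear T" shows "bounded_clinear (\<lambda>x. g (T x))"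
  using assms by (auto simp: bounded_clinear_def intro: bounded_linear_compose)

text \<open>A functional reduces the identity theorem to the scalar case.\<close>

lemma vector_identity_theorem:
  fixes Y Z :: "complex \<Rightarrow> 'a::complex_normed_vector"
  assumes Y: "vector_analytic_on Y (ball 0 \<delta>)" and Z: "vector_analytic_on Z (ball 0 \<delta>)"
    and eq: "\<And>t. 0 \<le> t \<Longrightarrow> t < \<delta> \<Longrightarrow> Y (of_real t) = Z (of_real t)"
    and z: "z \<in> ball 0 \<delta>"
  shows "Y z = Z z"
proof (rule ccontr)
  assume "Y z \<noteq> Z z"
  then have "Y z - Z z \<noteq> 0" by simp
  then obtain g :: "'a \<Rightarrow> complex" where g: "bounded_clinear g" "g (Y z - Z z) \<noteq> 0"
    by (rule functional_nonzero_at)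
  interpret g: bounded_linear g by (rule bounded_clinear_bounded_linear[OF g(1)])
  have \<delta>: "\<delta> > 0" using z by (auto intro: le_less_trans[OF norm_ge_zero])
  have hol: "(\<lambda>z. g (W z)) holomorphic_on ball 0 \<delta>" if W: "vector_analytic_on W (ball 0 \<delta>)" for W
    unfolding holomorphic_on_def
  proof
    fix z :: complex assume "z \<in> ball 0 \<delta>"
    then obtain d where "(W has_derivative (\<lambda>h. h *\<^sub>C d)) (at z)"
      using W unfolding vector_analytic_on_def by blast
    then have "((\<lambda>z. g (W z)) has_derivative (\<lambda>h. g (h *\<^sub>C d))) (at z)" by (rule g.has_derivative)
    moreover have "(\<lambda>h. g (h *\<^sub>C d)) = (*) (g d)"
      by (auto simp: fun_eq_iff bounded_clinear_scaleC[OF g(1)] scaleC_complex_def)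
    ultimately have "((\<lambda>z. g (W z)) has_field_derivative g d) (at z)"
      unfolding has_field_derivative_def by simp
    then show "(\<lambda>z. g (W z)) field_differentiable at z within ball 0 \<delta>"
      using field_differentiable_at_within field_differentiable_def by blast
  qed
  let ?U = "complex_of_real ` {0<..<\<delta>}"
  have "g (Y z) - g (Z z) = 0"
  proof (rule analytic_continuation[of "\<lambda>z. g (Y z) - g (Z z)" "ball 0 \<delta>" ?U 0])
    show "(\<lambda>z. g (Y z) - g (Z z)) holomorphic_on ball 0 \<delta>"
      by (intro holomorphic_on_diff hol Y Z)
    show "(0::complex) islimpt ?U"
      unfolding islimpt_approachable
    proof (intro allI impI)
      fix e :: real assume e: "e > 0"
      define q where "q = min e \<delta> / 2"
      have q: "0 < q" "q < \<delta>" "q < e" using e \<delta> by (auto simp: q_def)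
      then have "complex_of_real q \<in> ?U" "complex_of_real q \<noteq> 0" "dist (complex_of_real q) 0 < e" by auto
      then show "\<exists>x'\<in>?U. x' \<noteq> 0 \<and> dist x' 0 < e" by blast
    qed
    show "g (Y w) - g (Z w) = 0" if "w \<in> ?U" for w using that eq by auto
  qed (use \<delta> z in auto)
  then show False using g(2) by (simp add: g.diff)
qed

lemma vector_analytic_on_bounded_clinear:
  assumes "bounded_clinear T" "vector_analytic_on Y U"
  shows "vector_analytic_on (\<lambda>z. T (Y z)) U"
  unfolding vector_analytic_on_def
proof (intro conjI ballI)
  show "open U" using assms(2) by (simp add: vector_analytic_on_def)
  fix z assume "z \<in> U"
  then obtain d where "(Y has_derivative (\<lambda>h. h *\<^sub>C d)) (at z)"
    using assms(2) unfolding vector_analytic_on_def by blast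
  from bounded_linear.has_derivative[OF bounded_clinear_bounded_linear[OF assms(1)] this]
  have "((\<lambda>z. T (Y z)) has_derivative (\<lambda>h. h *\<^sub>C T d)) (at z)"
    by (simp only: bounded_clinear_scaleC[OF assms(1)])
  then show "\<exists>d. ((\<lambda>z. T (Y z)) has_derivative (\<lambda>h. h *\<^sub>C d)) (at z)" by blast
qed

section \<open>Bounded Borel functions and exponential weights\<close>

interpretation scaleC: bounded_bilinear "scaleC :: complex \<Rightarrow> 'a::complex_normed_vector \<Rightarrow> 'a"
proof
  show "(r *\<^sub>R a) *\<^sub>C b = r *\<^sub>R (a *\<^sub>C b)" "a *\<^sub>C (r *\<^sub>R b) = r *\<^sub>R (a *\<^sub>C b)" for r a and b :: 'a
    by (metis scaleC_of_real scaleC_scaleC scaleR_conv_of_real mult.commute)+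
  show "\<exists>K. \<forall>a (b::'a). norm (a *\<^sub>C b) \<le> norm a * norm b * K"
    by (rule exI[of _ 1]) (simp add: norm_scaleC)
qed (simp_all add: scaleC_add_left scaleC_add_right)

lemma scaleC_one [simp]: "1 *\<^sub>C x = x"
  using scaleC_of_real[of 1 x] by simp

text \<open>For coefficients in \<open>[0, B]\<close> the sum is \<open>B\<close> times a convex combination of the partial sums over
  subsets.  The induction peels off the smallest coefficient: it multiplies the full sum, and what
  remains is supported on a smaller set.\<close>

lemma norm_sum_scaleR_le:
  fixes v :: "'i \<Rightarrow> 'a::real_normed_vector"
  assumes "finite F" and "\<And>i. i \<in> F \<Longrightarrow> 0 \<le> a i \<and> a i \<le> B" and "B \<ge> 0"
    and "\<And>G. G \<subseteq> F \<Longrightarrow> norm (\<Sum>i\<in>G. v i) \<le> M"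
  shows "norm (\<Sum>i\<in>F. a i *\<^sub>R v i) \<le> B * M"
  using assms
proof (induction F arbitrary: a B rule: finite_psubset_induct)
  case (psubset F)
  have M: "M \<ge> 0" using psubset.prems(3)[of "{}"] by simp
  show ?case
  proof (cases "F = {}")
    case True
    then show ?thesis using M psubset.prems(2) by simp
  next
    case False
    then have "Min (a ` F) \<in> a ` F" using psubset.hyps by (intro Min_in) auto
    then obtain j where j: "j \<in> F" "a j = Min (a ` F)" by force
    have min: "a j \<le> a i" if "i \<in> F" for i
      using psubset.hyps that j(2) by simp
    have n1: "norm (\<Sum>i\<in>F - {j}. (a i - a j) *\<^sub>R v i) \<le> (B - a j) * M"
    proof (rule psubset.IH)
      show "F - {j} \<subset> F" using j by blast
      show "0 \<le> a i - a j \<and> a i - a j \<le> B - a j" if "i \<in> F - {j}" for i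
        using that min psubset.prems(1) by auto
      show "0 \<le> B - a j" using psubset.prems(1)[OF j(1)] by simp
      show "norm (\<Sum>i\<in>G. v i) \<le> M" if "G \<subseteq> F - {j}" for G
        using that by (intro psubset.prems(3)) auto
    qed
    have n2: "norm (a j *\<^sub>R (\<Sum>i\<in>F. v i)) \<le> a j * M"
      using psubset.prems(1)[OF j(1)] psubset.prems(3)[of F] by (auto intro: mult_left_mono)
    have split: "(\<Sum>i\<in>F. a i *\<^sub>R v i)
        = a j *\<^sub>R (\<Sum>i\<in>F. v i) + (\<Sum>i\<in>F - {j}. (a i - a j) *\<^sub>R v i)"
    proof -
      have "(\<Sum>i\<in>F. (a i - a j) *\<^sub>R v i) = (\<Sum>i\<in>F - {j}. (a i - a j) *\<^sub>R v i)"
        using psubset.hyps j by (subst sum.remove[of _ j]) auto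
      then show ?thesis
        by (simp add: scaleR_left_diff_distrib sum_subtractf scaleR_right.sum algebra_simps)
    qed
    have "norm (\<Sum>i\<in>F. a i *\<^sub>R v i) \<le> a j * M + (B - a j) * M"
      unfolding split by (rule norm_triangle_mono[OF n2 n1])
    then show ?thesis by (simp add: algebra_simps)
  qed
qed

lemma mult_norm_div_less:
  fixes e :: real assumes "e > 0" shows "e / (norm x + 1) * norm x < e"
proof -
  have "norm x + 1 > 0" using norm_ge_zero[of x] by linarith
  then show ?thesis using assms by (simp add: field_simps)
qed

definition bounded_borel :: "(complex \<Rightarrow> complex) \<Rightarrow> bool" where
  "bounded_borel \<phi> \<longleftrightarrow> \<phi> \<in> borel_measurable borel \<and> (\<exists>B. \<forall>z. norm (\<phi> z) \<le> B)"

lemma bounded_borelI: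
  "\<phi> \<in> borel_measurable borel \<Longrightarrow> (\<And>z. norm (\<phi> z) \<le> B) \<Longrightarrow> bounded_borel \<phi>"
  by (auto simp: bounded_borel_def)

lemma bounded_borel_add:
  assumes "bounded_borel \<phi>" "bounded_borel \<psi>" shows "bounded_borel (\<lambda>z. \<phi> z + \<psi> z)"
proof -
  from assms obtain B C where "\<And>z. norm (\<phi> z) \<le> B" "\<And>z. norm (\<psi> z) \<le> C"
    by (auto simp: bounded_borel_def)
  then show ?thesis using assms
    by (intro bounded_borelI[where B = "B + C"]) (auto simp: bounded_borel_def intro: norm_triangle_mono)
qed

lemma bounded_borel_mult:
  assumes "bounded_borel \<phi>" "bounded_borel \<psi>" shows "bounded_borel (\<lambda>z. \<phi> z * \<psi> z)"
proof -
  from assms obtain B C where "\<And>z. norm (\<phi> z) \<le> B" "\<And>z. norm (\<psi> z) \<le> C"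
    by (auto simp: bounded_borel_def)
  then show ?thesis using assms
    by (intro bounded_borelI[where B = "B * C"])
      (auto simp: bounded_borel_def norm_mult intro!: mult_mono order_trans[OF norm_ge_zero])
qed

lemma bounded_borel_const: "bounded_borel (\<lambda>z. c)"
  by (rule bounded_borelI[where B = "norm c"]) auto

lemma bounded_borel_indicator: "S \<in> sets borel \<Longrightarrow> bounded_borel (indicator S)"
  by (rule bounded_borelI[where B = 1]) (auto simp: indicator_def)

lemma bounded_borel_diff:
  assumes "bounded_borel \<phi>" "bounded_borel \<psi>" shows "bounded_borel (\<lambda>z. \<phi> z - \<psi> z)"
  using bounded_borel_add[OF assms(1) bounded_borel_mult[OF bounded_borel_const[of "-1"] assms(2)]]
  by simp

text \<open>Rounding real and imaginary part down to multiples of \<open>1 / (n + 1)\<close> leaves finitely many values.\<close>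

lemma bounded_borel_simple_approx:
  assumes "bounded_borel \<phi>"
  obtains s where "\<And>n. simple_function borel (s n)"
    "\<And>n z. norm (s n z - \<phi> z) \<le> 2 / real (Suc n)"
proof -
  from assms obtain B where m: "\<phi> \<in> borel_measurable borel" and B: "\<And>z. norm (\<phi> z) \<le> B"
    by (auto simp: bounded_borel_def)
  define d :: "nat \<Rightarrow> real \<Rightarrow> int" where "d n r = \<lfloor>real (Suc n) * r\<rfloor>" for n r
  define s where "s n z = Complex (of_int (d n (Re (\<phi> z))) / Suc n) (of_int (d n (Im (\<phi> z))) / Suc n)" for n z
  have sf: "simple_function borel (\<lambda>z. d n (f (\<phi> z)))"
    if f: "f \<in> borel_measurable borel" "\<And>w. \<bar>f w\<bar> \<le> norm w" for n f
  proof -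
    have "\<bar>f (\<phi> z)\<bar> \<le> B" for z using f(2)[of "\<phi> z"] B[of z] by linarith
    then have b: "- B \<le> f (\<phi> z)" "f (\<phi> z) \<le> B" for z by (smt (verit))+
    have "d n (- B) \<le> d n (f (\<phi> z))" "d n (f (\<phi> z)) \<le> d n B" for z
      unfolding d_def by (intro floor_mono mult_left_mono b; simp)+
    then have "range (\<lambda>z. d n (f (\<phi> z))) \<subseteq> {d n (- B)..d n B}" by auto
    then have "finite (range (\<lambda>z. d n (f (\<phi> z))))" by (rule finite_subset) simp
    moreover have "(\<lambda>z. real (Suc n) * f (\<phi> z)) \<in> borel_measurable borel"
      using f(1) m by measurable
    then have "(\<lambda>z. d n (f (\<phi> z))) \<in> measurable borel (count_space UNIV)"
      unfolding d_def by (rule measurable_compose[OF _ measurable_real_floor])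
    ultimately show ?thesis by (simp add: simple_function_eq_measurable)
  qed
  have "simple_function borel (s n)" for n
    unfolding s_def
    by (rule simple_function_compose2[where h = "\<lambda>a b. Complex (of_int a / Suc n) (of_int b / Suc n)"])
      (auto intro!: sf abs_Re_le_cmod abs_Im_le_cmod)
  moreover have "norm (s n z - \<phi> z) \<le> 2 / real (Suc n)" for n z
  proof -
    have e: "\<bar>of_int (d n r) / real (Suc n) - r\<bar> \<le> 1 / real (Suc n)" for r
    proof -
      have "\<bar>of_int (d n r) - real (Suc n) * r\<bar> \<le> 1"
        unfolding d_def by linarith
      moreover have "of_int (d n r) / real (Suc n) - r = (of_int (d n r) - real (Suc n) * r) / real (Suc n)"
        by (simp add: diff_divide_distrib)
      ultimately show ?thesis by (simp add: divide_right_mono)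
    qed
    have "norm (s n z - \<phi> z) \<le> \<bar>Re (s n z - \<phi> z)\<bar> + \<bar>Im (s n z - \<phi> z)\<bar>" by (rule cmod_le)
    also have "\<dots> \<le> 1 / real (Suc n) + 1 / real (Suc n)"
    proof (rule add_mono)
      show "\<bar>Re (s n z - \<phi> z)\<bar> \<le> 1 / real (Suc n)"
        unfolding s_def minus_complex.sel complex.sel by (rule e)
      show "\<bar>Im (s n z - \<phi> z)\<bar> \<le> 1 / real (Suc n)"
        unfolding s_def minus_complex.sel complex.sel by (rule e)
    qed
    finally show ?thesis by simp
  qed
  ultimately show ?thesis using that by blast
qed

lemma uniform_limit_inverse_Suc:
  fixes s :: "nat \<Rightarrow> complex \<Rightarrow> complex"
  assumes "\<And>n z. norm (s n z - \<phi> z) \<le> 2 / real (Suc n)"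
  shows "uniform_limit UNIV s \<phi> sequentially"
proof (rule uniform_limitI)
  fix e :: real assume e: "e > 0"
  have "(\<lambda>n. 2 / real (Suc n)) \<longlonglongrightarrow> 0" by real_asymp
  from order_tendstoD(2)[OF this e]
  show "\<forall>\<^sub>F n in sequentially. \<forall>z\<in>UNIV. dist (s n z) (\<phi> z) < e"
    by eventually_elim (use assms in \<open>auto simp: dist_norm intro: le_less_trans\<close>)
qed

text \<open>For such a \<open>\<phi>\<close> the functions \<open>l \<mapsto> exp (z l) \<phi>(l)\<close> with \<open>\<bar>z\<bar> \<le> r\<close> are bounded, so that the calculus
  applies to them although \<open>exp (z l)\<close> alone is unbounded.  Two instances matter: indicators of
  bounded sets, and \<open>exp (- t l)\<close> restricted to a spectrum of controlled growth.\<close>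

definition exp_tempered :: "real \<Rightarrow> (complex \<Rightarrow> complex) \<Rightarrow> bool" where
  "exp_tempered r \<phi> \<longleftrightarrow> \<phi> \<in> borel_measurable borel \<and>
     (\<exists>B. \<forall>l. exp (r * norm l) * norm (\<phi> l) \<le> B)"

lemma exp_tempered_indicator:
  assumes "\<Delta> \<in> sets borel" "\<Delta> \<subseteq> cball 0 R" "r \<ge> 0"
  shows "exp_tempered r (indicator \<Delta>)"
  unfolding exp_tempered_def
proof (intro conjI exI[of _ "exp (r * R)"] allI)
  fix l :: complex
  show "exp (r * norm l) * norm (indicator \<Delta> l :: complex) \<le> exp (r * R)"
    using assms(2,3) by (auto simp: indicator_def intro!: mult_left_mono)
qed (use assms in auto)

text \<open>A factor \<open>l\<close> is absorbed into \<open>exp (norm l)\<close>, which costs \<open>1\<close> in the admissible radius.\<close>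

lemma exp_tempered_bounded_borel:
  assumes "exp_tempered r \<phi>"
  shows "norm z \<le> r \<Longrightarrow> bounded_borel (\<lambda>l. exp (z * l) * \<phi> l)"
    and "norm z \<le> r - 1 \<Longrightarrow> bounded_borel (\<lambda>l. l * (exp (z * l) * \<phi> l))"
proof -
  obtain B where m: "\<phi> \<in> borel_measurable borel" and B: "\<And>l. exp (r * norm l) * norm (\<phi> l) \<le> B"
    using assms by (auto simp: exp_tempered_def)
  have e: "norm (exp (z * l)) \<le> exp (norm z * norm l)" for z l :: complex
    by (metis norm_exp norm_mult)
  show "bounded_borel (\<lambda>l. exp (z * l) * \<phi> l)" if z: "norm z \<le> r"
  proof (rule bounded_borelI[where B = B])
    show "(\<lambda>l. exp (z * l) * \<phi> l) \<in> borel_measurable borel" using m by measurable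
    fix l :: complex
    have "exp (norm z * norm l) \<le> exp (r * norm l)" using z by (simp add: mult_right_mono)
    then have "norm (exp (z * l) * \<phi> l) \<le> exp (r * norm l) * norm (\<phi> l)"
      unfolding norm_mult using e[of z l] by (intro mult_right_mono) auto
    then show "norm (exp (z * l) * \<phi> l) \<le> B" using B[of l] by linarith
  qed
  show "bounded_borel (\<lambda>l. l * (exp (z * l) * \<phi> l))" if z: "norm z \<le> r - 1"
  proof (rule bounded_borelI[where B = B])
    show "(\<lambda>l. l * (exp (z * l) * \<phi> l)) \<in> borel_measurable borel" using m by measurable
    fix l :: complex
    have "norm l \<le> exp (norm l)" using exp_ge_add_one_self[of "norm l"] by linarith
    then have "norm l * norm (exp (z * l)) \<le> exp (norm l) * exp (norm z * norm l)"
      using e[of z l] by (intro mult_mono) auto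
    also have "\<dots> = exp ((1 + norm z) * norm l)" by (simp add: exp_add[symmetric] algebra_simps)
    also have "\<dots> \<le> exp (r * norm l)" using z by (simp add: mult_right_mono)
    finally have "norm (l * (exp (z * l) * \<phi> l)) \<le> exp (r * norm l) * norm (\<phi> l)"
      unfolding norm_mult mult.assoc[symmetric] by (intro mult_right_mono) auto
    then show "norm (l * (exp (z * l) * \<phi> l)) \<le> B" using B[of l] by linarith
  qed
qed

lemma norm_exp_taylor2: "norm (exp w - 1 - w) \<le> exp (norm w) * (norm w)\<^sup>2" for w :: complex
  using Taylor_exp_field[of w 1] by (simp add: power2_eq_square diff_diff_eq)

section \<open>The functional calculus of a spectral measure\<close>

locale spectral =
  fixes E :: "complex set \<Rightarrow> 'a::complex_banach \<Rightarrow> 'a"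
  assumes spectral_measure: "spectral_measure E"
begin

lemma E_bounded_clinear: "S \<in> sets borel \<Longrightarrow> bounded_clinear (E S)"
  and E_empty [simp]: "E {} x = 0"
  and E_UNIV [simp]: "E UNIV x = x"
  and E_sums: "range F \<subseteq> sets borel \<Longrightarrow> disjoint_family F \<Longrightarrow> (\<lambda>n. E (F n) x) sums E (\<Union>n. F n) x"
  using spectral_measure by (auto simp: spectral_measure_def)

lemma E_E: "S \<in> sets borel \<Longrightarrow> T \<in> sets borel \<Longrightarrow> E S (E T x) = E (S \<inter> T) x"
  using spectral_measure unfolding spectral_measure_def by (metis comp_apply)

lemma E_bounded_linear: "S \<in> sets borel \<Longrightarrow> bounded_linear (E S)"
  by (intro bounded_clinear_bounded_linear E_bounded_clinear)

lemma E_Un_disjoint: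
  assumes "S \<in> sets borel" "T \<in> sets borel" "S \<inter> T = {}"
  shows "E (S \<union> T) x = E S x + E T x"
proof -
  have "(\<lambda>n. E (binaryset S T n) x) sums E (\<Union>n. binaryset S T n) x"
  proof (rule E_sums)
    show "range (binaryset S T) \<subseteq> sets borel" using assms by (auto simp: range_binaryset_eq)
    show "disjoint_family (binaryset S T)"
      using assms(3) by (auto simp: disjoint_family_on_def binaryset_def)
  qed
  moreover have "(\<lambda>n. E (binaryset S T n) x) sums (E S x + E T x)"
    by (rule binaryset_sums[where f = "\<lambda>S. E S x"]) simp
  ultimately show ?thesis using sums_unique2 by (simp add: UN_binaryset_eq) blast
qed

lemma E_Diff:
  assumes "S \<in> sets borel" "T \<in> sets borel" "T \<subseteq> S"
  shows "E (S - T) x = E S x - E T x"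
  using E_Un_disjoint[of "S - T" T x] assms by (simp add: Un_absorb2 Diff_Int_distrib Int_commute)

lemma E_UN_disjoint:
  assumes "finite J" "\<And>j. j \<in> J \<Longrightarrow> F j \<in> sets borel" "disjoint_family_on F J"
  shows "E (\<Union>j\<in>J. F j) x = (\<Sum>j\<in>J. E (F j) x)"
  using assms
proof (induction J)
  case (insert j J)
  have "E (F j \<union> (\<Union>j\<in>J. F j)) x = E (F j) x + E (\<Union>j\<in>J. F j) x"
    using insert.prems insert.hyps
    by (intro E_Un_disjoint sets.finite_UN) (auto simp: disjoint_family_on_def)
  moreover have "disjoint_family_on F J"
    using insert.prems by (auto simp: disjoint_family_on_def)
  ultimately show ?case using insert by simp
qed simp

text \<open>If the values on the subsets of \<open>S\<close> were unbounded, \<open>S\<close> could be split into two pieces,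
  one of them again with this defect and the other one of measure at least \<open>1\<close> in norm;
  repeating this yields disjoint sets whose measures do not tend to \<open>0\<close>.\<close>

lemma E_bounded_pointwise: "\<exists>B. \<forall>S\<in>sets borel. norm (E S x) \<le> B"
proof (rule ccontr)
  define bad where "bad S \<longleftrightarrow> S \<in> sets borel \<and>
    (\<forall>B. \<exists>T\<in>sets borel. T \<subseteq> S \<and> norm (E T x) > B)" for S
  assume "\<not> ?thesis"
  then have bad0: "bad UNIV" by (force simp: bad_def not_le)
  have step: "\<exists>S'. bad S' \<and> S' \<subseteq> S \<and> norm (E (S - S') x) \<ge> 1" if S: "bad S" for S
  proof -
    from S have SB: "S \<in> sets borel" by (simp add: bad_def)
    from S obtain T where T: "T \<in> sets borel" "T \<subseteq> S" "norm (E T x) > norm (E S x) + 1"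
      unfolding bad_def by blast
    have "norm (E (S - T) x) \<ge> 1"
      using norm_triangle_ineq2[of "E T x" "E S x"] T SB
      by (simp add: E_Diff norm_minus_commute)
    moreover have "norm (E (S - (S - T)) x) \<ge> 1"
      unfolding double_diff[OF T(2) subset_refl] using T(3) norm_ge_zero[of "E S x"] by linarith
    moreover have "bad T \<or> bad (S - T)"
    proof (rule ccontr)
      assume "\<not> ?thesis"
      then have "\<not> bad T" "\<not> bad (S - T)" by auto
      moreover have "S - T \<in> sets borel" using SB T by auto
      ultimately obtain B1 B2 where
        B1: "\<And>U. U \<in> sets borel \<Longrightarrow> U \<subseteq> T \<Longrightarrow> norm (E U x) \<le> B1" and
        B2: "\<And>U. U \<in> sets borel \<Longrightarrow> U \<subseteq> S - T \<Longrightarrow> norm (E U x) \<le> B2"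
        using T(1) unfolding bad_def by (meson not_less)
      from S obtain U where U: "U \<in> sets borel" "U \<subseteq> S" "norm (E U x) > B1 + B2"
        unfolding bad_def by blast
      have "E U x = E (U \<inter> T) x + E (U - T) x"
        using E_Diff[of U "U \<inter> T" x] U T by (simp add: Diff_Int)
      then have "norm (E U x) \<le> norm (E (U \<inter> T) x) + norm (E (U - T) x)"
        by (simp add: norm_triangle_ineq)
      also have "\<dots> \<le> B1 + B2" using U T by (intro add_mono B1 B2) auto
      finally show False using U by simp
    qed
    ultimately show ?thesis using T by blast
  qed
  obtain S where S: "\<And>n. bad (S n)" "\<And>n. S (Suc n) \<subseteq> S n" "\<And>n. norm (E (S n - S (Suc n)) x) \<ge> 1"
    using dependent_nat_choice[of "\<lambda>_. bad" "\<lambda>_ S S'. S' \<subseteq> S \<and> norm (E (S - S') x) \<ge> 1"]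
      bad0 step by (metis (no_types, lifting))
  define F where "F n = S n - S (Suc n)" for n
  have dec: "S n \<subseteq> S m" if "m \<le> n" for m n
    using that S(2) by (rule lift_Suc_antimono_le[rotated])
  have "F m \<inter> F n = {}" if "m < n" for m n
    using dec[of "Suc m" n] that by (auto simp: F_def)
  then have "disjoint_family F"
    unfolding disjoint_family_on_def by (metis inf_commute linorder_neqE_nat)
  moreover have "range F \<subseteq> sets borel" using S(1) by (auto simp: F_def bad_def)
  ultimately have "(\<lambda>n. E (F n) x) sums E (\<Union>n. F n) x" by (intro E_sums)
  then have "(\<lambda>n. E (F n) x) \<longlonglongrightarrow> 0" by (intro summable_LIMSEQ_zero sums_summable)
  then have "\<forall>\<^sub>F n in sequentially. norm (E (F n) x) < 1"
    by (intro order_tendstoD(2)[OF tendsto_norm_zero]) auto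
  then show False using S(3) by (auto simp: F_def eventually_sequentially not_le[symmetric])
qed

lemma E_uniformly_bounded: "\<exists>M\<ge>0. \<forall>S\<in>sets borel. \<forall>x. norm (E S x) \<le> M * norm x"
  by (intro uniform_boundedness E_bounded_linear E_bounded_pointwise)

abbreviation "simple_int \<equiv> simple_spectral_integral E"
abbreviation "calc \<equiv> spectral_integral E"

lemma simple_fibre_borel: "simple_function borel u \<Longrightarrow> u -` {c} \<in> sets borel"
  for u :: "complex \<Rightarrow> 'b"
  using simple_functionD(2)[of borel u "{c}"] by simp

lemma simple_range_finite: "simple_function borel u \<Longrightarrow> finite (range u)"
  for u :: "complex \<Rightarrow> 'b"
  using simple_functionD(1)[of borel u] by simp

text \<open>This lets the integral be computed over the finer partition into fibres of \<open>u\<close>.  With \<open>u\<close> a pair of simple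
  functions it gives the algebraic rules below.\<close>

lemma simple_int_comp:
  fixes u :: "complex \<Rightarrow> 'b"
  assumes u: "simple_function borel u"
  shows "simple_int (\<lambda>z. h (u z)) x = (\<Sum>b\<in>range u. h b *\<^sub>C E (u -` {b}) x)"
proof -
  have fin: "finite (range u)" using u by (rule simple_range_finite)
  have fib: "E ((\<lambda>z. h (u z)) -` {c}) x = (\<Sum>b\<in>{b \<in> range u. h b = c}. E (u -` {b}) x)" for c
  proof -
    have "(\<lambda>z. h (u z)) -` {c} = (\<Union>b\<in>{b \<in> range u. h b = c}. u -` {b})" by auto
    then show ?thesis
      using fin u by (simp, intro E_UN_disjoint) (auto simp: disjoint_family_on_def simple_fibre_borel)
  qed
  have "(\<Sum>b\<in>range u. h b *\<^sub>C E (u -` {b}) x)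
      = (\<Sum>c\<in>h ` range u. \<Sum>b\<in>{b \<in> range u. h b = c}. h b *\<^sub>C E (u -` {b}) x)"
    using fin by (rule sum.image_gen)
  also have "\<dots> = (\<Sum>c\<in>h ` range u. c *\<^sub>C E ((\<lambda>z. h (u z)) -` {c}) x)"
    unfolding fib scaleC.sum_right by (intro sum.cong) auto
  finally show ?thesis by (simp add: simple_spectral_integral_def image_image)
qed

lemma simple_int_add:
  assumes "simple_function borel s" "simple_function borel t"
  shows "simple_int (\<lambda>z. s z + t z) x = simple_int s x + simple_int t x"
proof -
  have u: "simple_function borel (\<lambda>z. (s z, t z))" using assms by auto
  show ?thesis
    using simple_int_comp[OF u, of "\<lambda>b. fst b + snd b" x] simple_int_comp[OF u, of fst x]
      simple_int_comp[OF u, of snd x]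
    by (simp add: scaleC_add_left sum.distrib)
qed

lemma simple_int_cmult:
  assumes "simple_function borel s"
  shows "simple_int (\<lambda>z. c * s z) x = c *\<^sub>C simple_int s x"
  using simple_int_comp[OF assms, of "\<lambda>b. c * b" x] 
  by (simp add: simple_spectral_integral_def scaleC.sum_right scaleC_scaleC)

lemma simple_int_diff:
  assumes "simple_function borel s" "simple_function borel t"
  shows "simple_int (\<lambda>z. s z - t z) x = simple_int s x - simple_int t x"
proof -
  have "simple_function borel (\<lambda>z. (-1) * t z)"
    using assms(2) by (rule simple_function_compose1)
  then show ?thesis
    using simple_int_add[OF assms(1), of "\<lambda>z. (-1) * t z" x] simple_int_cmult[OF assms(2), of "-1" x]
    by (simp add: scaleC.minus_left)
qed

lemma simple_int_mult:
  assumes "simple_function borel s" "simple_function borel t"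
  shows "simple_int (\<lambda>z. s z * t z) x = simple_int s (simple_int t x)"
proof -
  let ?u = "\<lambda>z. (s z, t z)"
  have u: "simple_function borel ?u" using assms by auto
  have fin: "finite (range s \<times> range t)" using assms by (simp add: simple_range_finite)
  have "simple_int (\<lambda>z. s z * t z) x = (\<Sum>b\<in>range ?u. (fst b * snd b) *\<^sub>C E (?u -` {b}) x)"
    using simple_int_comp[OF u, of "\<lambda>b. fst b * snd b" x] by simp
  also have "\<dots> = (\<Sum>b\<in>range s \<times> range t. (fst b * snd b) *\<^sub>C E (?u -` {b}) x)"
  proof (rule sum.mono_neutral_left[OF fin])
    show "\<forall>b\<in>range s \<times> range t - range ?u. (fst b * snd b) *\<^sub>C E (?u -` {b}) x = 0"
    proof
      fix b assume "b \<in> range s \<times> range t - range ?u"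
      then have "?u -` {b} = {}" by blast
      then show "(fst b * snd b) *\<^sub>C E (?u -` {b}) x = 0" by (simp only: E_empty scaleC.zero_right)
    qed
  qed auto
  also have "\<dots> = (\<Sum>c\<in>range s. \<Sum>d\<in>range t. (c * d) *\<^sub>C E (?u -` {(c, d)}) x)"
    by (simp add: sum.cartesian_product case_prod_unfold)
  also have "\<dots> = (\<Sum>c\<in>range s. c *\<^sub>C E (s -` {c}) (\<Sum>d\<in>range t. d *\<^sub>C E (t -` {d}) x))"
  proof (rule sum.cong[OF refl])
    fix c
    have c: "s -` {c} \<in> sets borel" using assms by (simp add: simple_fibre_borel)
    have "?u -` {(c, d)} = s -` {c} \<inter> t -` {d}" for d by auto
    then have "E (?u -` {(c, d)}) x = E (s -` {c}) (E (t -` {d}) x)" for d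
      using c assms by (simp add: E_E simple_fibre_borel)
    then show "(\<Sum>d\<in>range t. (c * d) *\<^sub>C E (?u -` {(c, d)}) x)
        = c *\<^sub>C E (s -` {c}) (\<Sum>d\<in>range t. d *\<^sub>C E (t -` {d}) x)"
      by (simp add: linear_sum[OF bounded_linear.linear[OF E_bounded_linear[OF c]]]
          bounded_clinear_scaleC[OF E_bounded_clinear[OF c]] scaleC.sum_right scaleC_scaleC)
  qed
  finally show ?thesis by (simp add: simple_spectral_integral_def)
qed

lemma simple_int_bounded_clinear:
  assumes s: "simple_function borel s"
  shows "bounded_clinear (simple_int s)"
proof -
  have "bounded_linear (\<lambda>x. \<Sum>c\<in>range s. c *\<^sub>C E (s -` {c}) x)"
    by (intro bounded_linear_sum bounded_linear_compose[OF scaleC.bounded_linear_right]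
        E_bounded_linear simple_fibre_borel s)
  moreover have "E (s -` {b}) (c *\<^sub>C x) = c *\<^sub>C E (s -` {b}) x" for b c x
    by (intro bounded_clinear_scaleC E_bounded_clinear simple_fibre_borel s)
  ultimately show ?thesis
    by (simp add: bounded_clinear_def simple_spectral_integral_def[abs_def] scaleC.sum_right
        scaleC_scaleC mult.commute)
qed

text \<open>Split a simple function into the positive and negative parts of its real and imaginary
  parts; a combination of the \<open>E\<close>-projections of a partition with coefficients in \<open>[0, B]\<close>
  is \<open>B\<close> times a convex combination of values of \<open>E\<close>.\<close>

lemma simple_int_norm_le:
  "\<exists>K>0. \<forall>s B x. simple_function borel s \<longrightarrow> (\<forall>z. norm (s z) \<le> B) \<longrightarrow>
     norm (simple_int s x) \<le> K * B * norm x"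
proof -
  obtain M where M: "M \<ge> 0" "\<And>S x. S \<in> sets borel \<Longrightarrow> norm (E S x) \<le> M * norm x"
    using E_uniformly_bounded by blast
  have "norm (simple_int s x) \<le> (4 * M + 1) * B * norm x"
    if s: "simple_function borel s" and B: "\<And>z. norm (s z) \<le> B" for s B x
  proof -
    have B0: "B \<ge> 0" using B[of 0] by (meson norm_ge_zero order_trans)
    let ?v = "\<lambda>c. E (s -` {c}) x"
    have fin: "finite (range s)" using s by (rule simple_range_finite)
    have part: "norm (\<Sum>c\<in>G. ?v c) \<le> M * norm x" if G: "G \<subseteq> range s" for G
    proof -
      have fG: "finite G" using G fin by (rule finite_subset)
      have "(\<Sum>c\<in>G. ?v c) = E (\<Union>c\<in>G. s -` {c}) x"
        using fG s by (intro E_UN_disjoint[symmetric]) (auto simp: disjoint_family_on_def simple_fibre_borel)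
      also have "norm \<dots> \<le> M * norm x"
        using fG s by (intro M sets.finite_UN) (auto simp: simple_fibre_borel)
      finally show ?thesis .
    qed
    have pos: "norm (\<Sum>c\<in>range s. h c *\<^sub>R ?v c) \<le> B * (M * norm x)"
      if "\<And>c. 0 \<le> h c" "\<And>c. h c \<le> norm c" for h :: "complex \<Rightarrow> real"
      by (intro norm_sum_scaleR_le fin B0 part) (use that B order_trans in blast)+
    define h1 h2 h3 h4 where h: "h1 c = max 0 (Re c)" "h2 c = max 0 (- Re c)"
      "h3 c = max 0 (Im c)" "h4 c = max 0 (- Im c)" for c
    have hb: "norm (\<Sum>c\<in>range s. k c *\<^sub>R ?v c) \<le> B * (M * norm x)" if "k \<in> {h1, h2, h3, h4}" for k
      by (rule pos) (use that abs_Re_le_cmod abs_Im_le_cmod in \<open>auto simp: h abs_le_iff\<close>)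
    have dec: "c = complex_of_real (h1 c) - complex_of_real (h2 c)
        + \<i> * (complex_of_real (h3 c) - complex_of_real (h4 c))" for c
      by (simp add: complex_eq_iff h max_def)
    have dec': "c *\<^sub>C v = h1 c *\<^sub>R v - h2 c *\<^sub>R v + \<i> *\<^sub>C (h3 c *\<^sub>R v - h4 c *\<^sub>R v)" for c and v :: 'a
      using arg_cong[OF dec[of c], of "\<lambda>w. w *\<^sub>C v"]
      by (simp only: scaleC_add_left scaleC.diff_left scaleC_scaleC[symmetric] scaleC_of_real)
    have "simple_int s x = (\<Sum>c\<in>range s. h1 c *\<^sub>R ?v c - h2 c *\<^sub>R ?v c
        + \<i> *\<^sub>C (h3 c *\<^sub>R ?v c - h4 c *\<^sub>R ?v c))"
      unfolding simple_spectral_integral_def by (intro sum.cong refl dec')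
    also have "\<dots> = ((\<Sum>c\<in>range s. h1 c *\<^sub>R ?v c) - (\<Sum>c\<in>range s. h2 c *\<^sub>R ?v c))
        + \<i> *\<^sub>C ((\<Sum>c\<in>range s. h3 c *\<^sub>R ?v c) - (\<Sum>c\<in>range s. h4 c *\<^sub>R ?v c))"
      by (simp add: sum.distrib sum_subtractf scaleC.sum_right scaleC.diff_right)
    also have "norm \<dots> \<le> (B * (M * norm x) + B * (M * norm x)) + (B * (M * norm x) + B * (M * norm x))"
    proof (rule norm_triangle_mono)
      have *: "norm (v - w) \<le> W + W" if "norm v \<le> W" "norm w \<le> W" for v w :: 'a and W
        using norm_triangle_ineq4[of v w] that by linarith
      show "norm ((\<Sum>c\<in>range s. h1 c *\<^sub>R ?v c) - (\<Sum>c\<in>range s. h2 c *\<^sub>R ?v c))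
          \<le> B * (M * norm x) + B * (M * norm x)" by (intro * hb) auto
      show "norm (\<i> *\<^sub>C ((\<Sum>c\<in>range s. h3 c *\<^sub>R ?v c) - (\<Sum>c\<in>range s. h4 c *\<^sub>R ?v c)))
          \<le> B * (M * norm x) + B * (M * norm x)"
        unfolding norm_scaleC norm_ii mult_1 by (intro * hb) auto
    qed
    also have "\<dots> \<le> (4 * M + 1) * B * norm x" using B0 by (simp add: algebra_simps)
    finally show ?thesis .
  qed
  then show ?thesis using M(1) by (intro exI[of _ "4 * M + 1"]) auto
qed

text \<open>Fixing one such constant keeps existential quantifiers out of the later estimates.\<close>

definition K where "K = (SOME K. K > 0 \<and> (\<forall>s B x. simple_function borel s \<longrightarrow>
  (\<forall>z. norm (s z) \<le> B) \<longrightarrow> norm (simple_int s x) \<le> K * B * norm x))"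

lemma K_pos: "K > 0"
  and simple_int_norm: "simple_function borel s \<Longrightarrow> (\<And>z. norm (s z) \<le> B) \<Longrightarrow>
    norm (simple_int s x) \<le> K * B * norm x"
  using someI_ex[OF simple_int_norm_le] unfolding K_def[symmetric] by auto

lemma simple_int_dist:
  assumes "simple_function borel s" "simple_function borel t" "\<And>z. norm (s z - t z) \<le> e"
  shows "norm (simple_int s x - simple_int t x) \<le> K * e * norm x"
  using simple_int_norm[of "\<lambda>z. s z - t z" e x] assms
    simple_function_compose2[OF assms(1,2), of "\<lambda>a b. a - b"] simple_int_diff[OF assms(1,2), of x]
  by simp

lemma has_spectral_integral_exists:
  assumes s: "\<And>n. simple_function borel (s n)" and lim: "uniform_limit UNIV s \<phi> sequentially"
  shows "\<exists>T. has_spectral_integral E \<phi> T \<and> (\<forall>x. (\<lambda>n. simple_int (s n) x) \<longlonglongrightarrow> T x)"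
proof -
  have cau: "\<exists>N. \<forall>m\<ge>N. \<forall>n\<ge>N. \<forall>x. norm (simple_int (s m) x - simple_int (s n) x) \<le> e * norm x"
    if e: "e > 0" for e
  proof -
    have "\<forall>\<^sub>F n in sequentially. \<forall>z\<in>UNIV. dist (s n z) (\<phi> z) < e / K / 2"
      using e K_pos by (intro uniform_limitD[OF lim]) auto
    then obtain N where N: "\<And>n z. n \<ge> N \<Longrightarrow> norm (s n z - \<phi> z) < e / K / 2"
      by (auto simp: eventually_sequentially dist_norm)
    have "norm (simple_int (s m) x - simple_int (s n) x) \<le> e * norm x" if "m \<ge> N" "n \<ge> N" for m n x
    proof -
      have "norm (s m z - s n z) \<le> e / K" for z
        using norm_triangle_ineq4[of "s m z - \<phi> z" "s n z - \<phi> z"] N[OF that(1), of z] N[OF that(2), of z]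
        by simp
      then show ?thesis using simple_int_dist[OF s s, of m n "e / K" x] K_pos by simp
    qed
    then show ?thesis by blast
  qed
  have "Cauchy (\<lambda>n. simple_int (s n) x)" for x
  proof (rule CauchyI)
    fix e :: real assume e: "e > 0"
    have "e / (norm x + 1) > 0" using e by (simp add: add_nonneg_pos)
    from cau[OF this] obtain N where
      N: "\<And>m n. m \<ge> N \<Longrightarrow> n \<ge> N \<Longrightarrow> norm (simple_int (s m) x - simple_int (s n) x) \<le> e / (norm x + 1) * norm x"
      by blast
    have "e / (norm x + 1) * norm x < e" using e by (rule mult_norm_div_less)
    then show "\<exists>M. \<forall>m\<ge>M. \<forall>n\<ge>M. norm (simple_int (s m) x - simple_int (s n) x) < e"
      using N by (metis le_less_trans)
  qed
  then have "\<exists>l. (\<lambda>n. simple_int (s n) x) \<longlonglongrightarrow> l" for x by (simp add: Cauchy_convergent_iff convergent_def)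
  then obtain T where T: "\<And>x. (\<lambda>n. simple_int (s n) x) \<longlonglongrightarrow> T x" by metis
  have close: "\<exists>N. \<forall>n\<ge>N. \<forall>x. norm (simple_int (s n) x - T x) \<le> e * norm x" if e: "e > 0" for e
  proof -
    from cau[OF e] obtain N where
      N: "\<And>m n x. m \<ge> N \<Longrightarrow> n \<ge> N \<Longrightarrow> norm (simple_int (s m) x - simple_int (s n) x) \<le> e * norm x"
      by blast
    have "norm (simple_int (s n) x - T x) \<le> e * norm x" if "n \<ge> N" for n x
    proof (rule tendsto_upperbound)
      show "(\<lambda>m. norm (simple_int (s n) x - simple_int (s m) x)) \<longlonglongrightarrow> norm (simple_int (s n) x - T x)"
        by (intro tendsto_intros T)
      show "\<forall>\<^sub>F m in sequentially. norm (simple_int (s n) x - simple_int (s m) x) \<le> e * norm x"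
        using N that by (auto simp: eventually_sequentially)
    qed simp
    then show ?thesis by blast
  qed
  have lin: "bounded_clinear (simple_int (s n))" for n by (rule simple_int_bounded_clinear[OF s])
  have bl: "bounded_linear (simple_int (s n))" for n by (intro bounded_clinear_bounded_linear lin)
  have "bounded_linear T"
  proof -
    from close[of 1] obtain N where N: "\<And>x. norm (simple_int (s N) x - T x) \<le> norm x" by auto
    obtain L where L: "\<And>x. norm (simple_int (s N) x) \<le> norm x * L"
      using bounded_linear.bounded[OF bl] by blast
    show ?thesis
    proof (rule bounded_linear_intro[where K = "L + 1"])
      show "T (x + y) = T x + T y" for x y
      proof (rule LIMSEQ_unique[OF T])
        show "(\<lambda>n. simple_int (s n) (x + y)) \<longlonglongrightarrow> T x + T y"
          using tendsto_add[OF T T] by (simp add: linear_add[OF bounded_linear.linear[OF bl]])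
      qed
      show "T (r *\<^sub>R x) = r *\<^sub>R T x" for r x
      proof (rule LIMSEQ_unique[OF T])
        show "(\<lambda>n. simple_int (s n) (r *\<^sub>R x)) \<longlonglongrightarrow> r *\<^sub>R T x"
          using tendsto_scaleR[OF tendsto_const T] by (simp add: linear_scale[OF bounded_linear.linear[OF bl]])
      qed
      show "norm (T x) \<le> norm x * (L + 1)" for x
        using norm_triangle_ineq2[of "T x" "simple_int (s N) x"] N[of x] L[of x]
        by (simp add: algebra_simps norm_minus_commute)
    qed
  qed
  moreover have "T (c *\<^sub>C x) = c *\<^sub>C T x" for c x
  proof (rule LIMSEQ_unique[OF T])
    show "(\<lambda>n. simple_int (s n) (c *\<^sub>C x)) \<longlonglongrightarrow> c *\<^sub>C T x"
      using scaleC.tendsto[OF tendsto_const T] by (simp add: bounded_clinear_scaleC[OF lin])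
  qed
  ultimately have Tc: "bounded_clinear T" by (simp add: bounded_clinear_def)
  have "(\<lambda>n. onorm (\<lambda>x. simple_int (s n) x - T x)) \<longlonglongrightarrow> 0"
  proof (rule LIMSEQ_I)
    fix e :: real assume e: "e > 0"
    then obtain N where N: "\<And>n x. n \<ge> N \<Longrightarrow> norm (simple_int (s n) x - T x) \<le> (e / 2) * norm x"
      using close[of "e / 2"] by auto
    have "norm (onorm (\<lambda>x. simple_int (s n) x - T x) - 0) < e" if "n \<ge> N" for n
    proof -
      have "onorm (\<lambda>x. simple_int (s n) x - T x) \<le> e / 2" using e N[OF that] by (intro onorm_bound) auto
      moreover have "onorm (\<lambda>x. simple_int (s n) x - T x) \<ge> 0"
        by (intro onorm_pos_le bounded_linear_sub bl \<open>bounded_linear T\<close>)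
      ultimately show ?thesis using e by simp
    qed
    then show "\<exists>N. \<forall>n\<ge>N. norm (onorm (\<lambda>x. simple_int (s n) x - T x) - 0) < e" by blast
  qed
  then have "has_spectral_integral E \<phi> T"
    unfolding has_spectral_integral_def using Tc s lim by blast
  then show ?thesis using T by blast
qed

text \<open>Any approximating sequence computes the integral, since the integrals of two of them differ
  by at most a multiple of their uniform distance.  This makes the integral unique and provides
  the freedom of choice needed for sums and products.\<close>

lemma has_spectral_integral_limit:
  assumes T: "has_spectral_integral E \<phi> T"
    and s: "\<And>n. simple_function borel (s n)" and lim: "uniform_limit UNIV s \<phi> sequentially"
  shows "(\<lambda>n. simple_int (s n) x) \<longlonglongrightarrow> T x"
proof -
  from T obtain t where Tl: "bounded_clinear T" and t: "\<And>n. simple_function borel (t n)"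
    "uniform_limit UNIV t \<phi> sequentially"
    "(\<lambda>n. onorm (\<lambda>x. simple_int (t n) x - T x)) \<longlonglongrightarrow> 0"
    unfolding has_spectral_integral_def by blast
  have bl: "bounded_linear (\<lambda>x. simple_int (t n) x - T x)" for n
    by (intro bounded_linear_sub bounded_clinear_bounded_linear simple_int_bounded_clinear t Tl)
  have "(\<lambda>n. simple_int (t n) x - T x) \<longlonglongrightarrow> 0"
  proof (rule Lim_null_comparison)
    show "\<forall>\<^sub>F n in sequentially. norm (simple_int (t n) x - T x)
        \<le> onorm (\<lambda>x. simple_int (t n) x - T x) * norm x"
      using onorm[OF bl] by auto
    show "(\<lambda>n. onorm (\<lambda>x. simple_int (t n) x - T x) * norm x) \<longlonglongrightarrow> 0"
      using tendsto_mult_right[OF t(3), of "norm x"] by simp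
  qed
  moreover have "(\<lambda>n. simple_int (s n) x - simple_int (t n) x) \<longlonglongrightarrow> 0"
  proof (rule LIMSEQ_I)
    fix e :: real assume e: "e > 0"
    define d where "d = e / (K * (norm x + 1)) / 2"
    have d: "d > 0" using e K_pos by (simp add: d_def add_nonneg_pos)
    have "\<forall>\<^sub>F n in sequentially. norm (simple_int (s n) x - simple_int (t n) x) < e"
      using uniform_limitD[OF lim d] uniform_limitD[OF t(2) d]
    proof eventually_elim
      case (elim n)
      have "norm (s n z - t n z) \<le> 2 * d" for z
        using elim[THEN bspec, of z] norm_triangle_ineq4[of "s n z - \<phi> z" "t n z - \<phi> z"]
        by (simp add: dist_norm)
      then have "norm (simple_int (s n) x - simple_int (t n) x) \<le> K * (2 * d) * norm x"
        by (intro simple_int_dist s t)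
      also have "\<dots> = e / (norm x + 1) * norm x" using K_pos by (simp add: d_def)
      also have "\<dots> < e" using e by (rule mult_norm_div_less)
      finally show ?case .
    qed
    then show "\<exists>N. \<forall>n\<ge>N. norm (simple_int (s n) x - simple_int (t n) x - 0) < e"
      by (simp add: eventually_sequentially)
  qed
  ultimately have "(\<lambda>n. (simple_int (t n) x - T x) + (simple_int (s n) x - simple_int (t n) x)) \<longlonglongrightarrow> 0 + 0"
    by (intro tendsto_add)
  then show ?thesis by (simp add: LIM_zero_iff)
qed

lemma calc_limit:
  assumes s: "\<And>n. simple_function borel (s n)" and lim: "uniform_limit UNIV s \<phi> sequentially"
  shows "bounded_clinear (calc \<phi>)" "(\<lambda>n. simple_int (s n) x) \<longlonglongrightarrow> calc \<phi> x"
proof -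
  obtain T where T: "has_spectral_integral E \<phi> T"
    using has_spectral_integral_exists[OF s lim] by blast
  have "T' = T" if "has_spectral_integral E \<phi> T'" for T'
    using has_spectral_integral_limit[OF that s lim] has_spectral_integral_limit[OF T s lim]
    by (auto intro: LIMSEQ_unique)
  then have "calc \<phi> = T" unfolding spectral_integral_def using T by (intro the_equality)
  then show "bounded_clinear (calc \<phi>)" "(\<lambda>n. simple_int (s n) x) \<longlonglongrightarrow> calc \<phi> x"
    using T has_spectral_integral_limit[OF T s lim] by (auto simp: has_spectral_integral_def)
qed

lemma calc_bounded_clinear: "bounded_borel \<phi> \<Longrightarrow> bounded_clinear (calc \<phi>)"
  by (metis bounded_borel_simple_approx uniform_limit_inverse_Suc calc_limit(1))

lemma calc_bounded_linear: "bounded_borel \<phi> \<Longrightarrow> bounded_linear (calc \<phi>)"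
  by (intro bounded_clinear_bounded_linear calc_bounded_clinear)

lemma calc_norm:
  assumes \<phi>: "bounded_borel \<phi>" and B: "\<And>z. norm (\<phi> z) \<le> B"
  shows "norm (calc \<phi> x) \<le> K * B * norm x"
proof -
  obtain s where s: "\<And>n. simple_function borel (s n)"
    and b: "\<And>n z. norm (s n z - \<phi> z) \<le> 2 / real (Suc n)"
    using bounded_borel_simple_approx[OF \<phi>] by blast
  have "(\<lambda>n. norm (simple_int (s n) x)) \<longlonglongrightarrow> norm (calc \<phi> x)"
    by (intro tendsto_norm calc_limit(2) s uniform_limit_inverse_Suc b)
  moreover have "(\<lambda>n. K * (B + 2 / real (Suc n)) * norm x) \<longlonglongrightarrow> K * (B + 0) * norm x"
  proof -
    have "(\<lambda>n. 2 / real (Suc n)) \<longlonglongrightarrow> 0" by real_asymp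
    then show ?thesis by (intro tendsto_intros)
  qed
  then have "(\<lambda>n. K * (B + 2 / real (Suc n)) * norm x) \<longlonglongrightarrow> K * B * norm x" by simp
  moreover have "norm (simple_int (s n) x) \<le> K * (B + 2 / real (Suc n)) * norm x" for n
  proof (rule simple_int_norm[OF s])
    show "norm (s n z) \<le> B + 2 / real (Suc n)" for z
      using norm_triangle_ineq2[of "s n z" "\<phi> z"] b[of n z] B[of z] by linarith
  qed
  ultimately show ?thesis by (intro LIMSEQ_le) auto
qed

lemma calc_simple:
  assumes "simple_function borel s" shows "calc s x = simple_int s x"
  using calc_limit(2)[of "\<lambda>n. s" s x] assms
  by (simp add: LIMSEQ_const_iff uniform_limit_const)

lemma calc_indicator:
  assumes S: "S \<in> sets borel" shows "calc (indicator S) x = E S x"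
proof -
  have s: "simple_function borel (indicator S :: complex \<Rightarrow> complex)" 
    using simple_function_indicator[of S borel] S by auto
  have "simple_function borel (\<lambda>z. z \<in> S)"
    using S by (simp add: simple_function_eq_measurable)
  from simple_int_comp[OF this, of "\<lambda>b. if b then 1 else 0" x]
  have "simple_int (indicator S) x = (\<Sum>b\<in>range (\<lambda>z. z \<in> S). (if b then 1 else 0) *\<^sub>C E ((\<lambda>z. z \<in> S) -` {b}) x)"
    by (simp add: indicator_def[abs_def] of_bool_def)
  also have "\<dots> = (\<Sum>b\<in>UNIV. (if b then 1 else 0) *\<^sub>C E ((\<lambda>z. z \<in> S) -` {b}) x)"
  proof (rule sum.mono_neutral_left)
    show "\<forall>b\<in>UNIV - range (\<lambda>z. z \<in> S). (if b then 1 else 0) *\<^sub>C E ((\<lambda>z. z \<in> S) -` {b}) x = 0"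
    proof
      fix b assume "b \<in> UNIV - range (\<lambda>z. z \<in> S)"
      then have "(\<lambda>z. z \<in> S) -` {b} = {}" by blast
      then show "(if b then 1 else 0) *\<^sub>C E ((\<lambda>z. z \<in> S) -` {b}) x = 0"
        by (simp only: E_empty scaleC.zero_right)
    qed
  qed auto
  also have "\<dots> = E S x" by (simp add: UNIV_bool vimage_def scaleC.zero_left)
  finally show ?thesis using s by (simp add: calc_simple)
qed

lemma calc_add:
  assumes "bounded_borel \<phi>" "bounded_borel \<psi>"
  shows "calc (\<lambda>z. \<phi> z + \<psi> z) x = calc \<phi> x + calc \<psi> x"
proof -
  obtain s where s: "\<And>n. simple_function borel (s n)" "uniform_limit UNIV s \<phi> sequentially"
    using bounded_borel_simple_approx[OF assms(1)] uniform_limit_inverse_Suc by metis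
  obtain t where t: "\<And>n. simple_function borel (t n)" "uniform_limit UNIV t \<psi> sequentially"
    using bounded_borel_simple_approx[OF assms(2)] uniform_limit_inverse_Suc by metis
  have "(\<lambda>n. simple_int (\<lambda>z. s n z + t n z) x) \<longlonglongrightarrow> calc (\<lambda>z. \<phi> z + \<psi> z) x"
    by (intro calc_limit uniform_limit_add s t simple_function_compose2[where h = "(+)"])
  moreover have "(\<lambda>n. simple_int (\<lambda>z. s n z + t n z) x) \<longlonglongrightarrow> calc \<phi> x + calc \<psi> x"
    using tendsto_add[OF calc_limit(2)[OF s] calc_limit(2)[OF t]] by (simp add: simple_int_add s t)
  ultimately show ?thesis by (rule LIMSEQ_unique)
qed

lemma calc_mult:
  assumes "bounded_borel \<phi>" "bounded_borel \<psi>"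
  shows "calc (\<lambda>z. \<phi> z * \<psi> z) x = calc \<phi> (calc \<psi> x)"
proof -
  obtain s where s: "\<And>n. simple_function borel (s n)"
    and sb: "\<And>n z. norm (s n z - \<phi> z) \<le> 2 / real (Suc n)"
    using bounded_borel_simple_approx[OF assms(1)] by metis
  obtain t where t: "\<And>n. simple_function borel (t n)"
    and tb: "\<And>n z. norm (t n z - \<psi> z) \<le> 2 / real (Suc n)"
    using bounded_borel_simple_approx[OF assms(2)] by metis
  note sl = uniform_limit_inverse_Suc[OF sb] and tl = uniform_limit_inverse_Suc[OF tb]
  obtain B C where B: "\<And>z. norm (\<phi> z) \<le> B" and C: "\<And>z. norm (\<psi> z) \<le> C"
    using assms by (auto simp: bounded_borel_def)
  have "bounded (range \<phi>)" "bounded (range \<psi>)" using B C by (auto simp: bounded_iff)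
  then have "uniform_limit UNIV (\<lambda>n z. s n z * t n z) (\<lambda>z. \<phi> z * \<psi> z) sequentially"
    by (intro uniform_lim_mult sl tl)
  then have "(\<lambda>n. simple_int (\<lambda>z. s n z * t n z) x) \<longlonglongrightarrow> calc (\<lambda>z. \<phi> z * \<psi> z) x"
    by (intro calc_limit simple_function_compose2[where h = "(*)"] s t)
  moreover have "(\<lambda>n. simple_int (s n) (simple_int (t n) x)) \<longlonglongrightarrow> calc \<phi> (calc \<psi> x)"
  proof -
    have "(\<lambda>n. simple_int (s n) (simple_int (t n) x - calc \<psi> x)) \<longlonglongrightarrow> 0"
    proof (rule Lim_null_comparison)
      have "norm (s n z) \<le> B + 2" for n z
      proof -
        have "2 / real (Suc n) \<le> 2" by (simp add: field_simps)
        then show ?thesis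
          using norm_triangle_ineq2[of "s n z" "\<phi> z"] sb[of n z] B[of z] by linarith
      qed
      then show "\<forall>\<^sub>F n in sequentially. norm (simple_int (s n) (simple_int (t n) x - calc \<psi> x))
          \<le> K * (B + 2) * norm (simple_int (t n) x - calc \<psi> x)"
        by (intro always_eventually allI simple_int_norm s)
      show "(\<lambda>n. K * (B + 2) * norm (simple_int (t n) x - calc \<psi> x)) \<longlonglongrightarrow> 0"
        by (intro tendsto_mult_right_zero tendsto_norm_zero LIM_zero calc_limit t tl)
    qed
    from tendsto_add[OF this calc_limit(2)[OF s sl, of "calc \<psi> x"]]
    show ?thesis
      by (simp add: linear_diff[OF bounded_linear.linear[OF bounded_clinear_bounded_linear[OF simple_int_bounded_clinear[OF s]]]])
  qed
  ultimately show ?thesis by (simp add: simple_int_mult s t LIMSEQ_unique)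
qed

lemma calc_const: "calc (\<lambda>z. c) x = c *\<^sub>C x"
proof -
  have "simple_int (\<lambda>z. c) x = c *\<^sub>C x"
    by (simp add: simple_spectral_integral_def vimage_def)
  then show ?thesis by (simp add: calc_simple)
qed

lemma calc_cmult:
  assumes "bounded_borel \<phi>" shows "calc (\<lambda>z. c * \<phi> z) x = c *\<^sub>C calc \<phi> x"
  using calc_mult[OF bounded_borel_const assms, of c x] by (simp add: calc_const)

lemma calc_diff:
  assumes "bounded_borel \<phi>" "bounded_borel \<psi>"
  shows "calc (\<lambda>z. \<phi> z - \<psi> z) x = calc \<phi> x - calc \<psi> x"
  using calc_add[OF assms(1) bounded_borel_mult[OF bounded_borel_const[of "-1"] assms(2)], of x]
    calc_cmult[OF assms(2), of "-1" x] by (simp add: scaleC.minus_left)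

section \<open>The support of a spectral measure\<close>

text \<open>The disjointed sets are still null, because \<open>E\<close> of a subset factors through \<open>E\<close> of the larger set.\<close>

lemma E_null_UN:
  fixes U :: "nat \<Rightarrow> complex set"
  assumes "range U \<subseteq> sets borel" "\<And>n x. E (U n) x = 0"
  shows "E (\<Union>n. U n) x = 0"
proof -
  have B: "disjointed U n \<in> sets borel" for n
    using sets.range_disjointed_sets[OF assms(1)] by auto
  have "E (disjointed U n) x = 0" for n
  proof -
    have "E (disjointed U n) x = E (disjointed U n) (E (U n) x)"
      using B assms(1) disjointed_subset[of U n] by (subst E_E) (auto simp: Int_absorb2)
    then show ?thesis
      by (simp add: assms(2) linear_0[OF bounded_linear.linear[OF E_bounded_linear[OF B]]])
  qed
  moreover have "(\<lambda>n. E (disjointed U n) x) sums E (\<Union>n. disjointed U n) x"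
    using B by (intro E_sums disjoint_family_disjointed) auto
  ultimately show ?thesis by (simp add: UN_disjointed_eq sums_0 sums_unique2[OF _ sums_zero])
qed

lemma E_incseq_tendsto:
  fixes A :: "nat \<Rightarrow> complex set"
  assumes "range A \<subseteq> sets borel" "incseq A"
  shows "(\<lambda>n. E (A n) x) \<longlonglongrightarrow> E (\<Union>n. A n) x"
proof -
  have B: "disjointed A n \<in> sets borel" for n
    using sets.range_disjointed_sets[OF assms(1)] by auto
  have "(\<lambda>n. E (disjointed A n) x) sums E (\<Union>n. disjointed A n) x"
    using B by (intro E_sums disjoint_family_disjointed) auto
  then have "(\<lambda>n. \<Sum>i<n. E (disjointed A i) x) \<longlonglongrightarrow> E (\<Union>n. A n) x"
    by (simp add: sums_def UN_disjointed_eq)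
  then have "(\<lambda>n. \<Sum>i<Suc n. E (disjointed A i) x) \<longlonglongrightarrow> E (\<Union>n. A n) x" by (rule LIMSEQ_Suc)
  moreover have "(\<Sum>i<Suc n. E (disjointed A i) x) = E (A n) x" for n
  proof -
    have "(\<Sum>i<Suc n. E (disjointed A i) x) = E (\<Union>i\<in>{0..<Suc n}. disjointed A i) x"
      unfolding lessThan_atLeast0
    proof (rule E_UN_disjoint[symmetric])
      show "disjoint_family_on (disjointed A) {0..<Suc n}"
        by (rule disjoint_family_on_mono[OF subset_UNIV disjoint_family_disjointed])
    qed (use B in auto)
    also have "(\<Union>i\<in>{0..<Suc n}. disjointed A i) = A n"
      unfolding finite_UN_disjointed_eq using incseqD[OF assms(2)] by (auto simp: less_Suc_eq_le) blast
    finally show ?thesis .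
  qed
  ultimately show ?thesis by simp
qed

abbreviation "supp \<equiv> spectral_support E"

lemma open_Compl_supp: "open (- supp)"
proof -
  have "- supp = \<Union>{U. open U \<and> E U = (\<lambda>x. 0)}" by (auto simp: spectral_support_def)
  then show ?thesis by auto
qed

lemma supp_borel [measurable, simp]: "supp \<in> sets borel"
  using open_Compl_supp by (intro borel_closed) (simp add: closed_def)

text \<open>The complement of the support is a union of open null sets; by Lindelof countably many suffice.\<close>

lemma E_Compl_supp: "E (- supp) x = 0"
proof -
  have eq: "- supp = \<Union>{U. open U \<and> E U = (\<lambda>x. 0)}" by (auto simp: spectral_support_def)
  obtain \<U> where U: "\<U> \<subseteq> {U. open U \<and> E U = (\<lambda>x. 0)}" "countable \<U>"
    "\<Union>\<U> = \<Union>{U. open U \<and> E U = (\<lambda>x. 0)}"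
    by (rule Lindelof[of "{U. open U \<and> E U = (\<lambda>x. 0)}"]) auto
  show ?thesis
  proof (cases "\<U> = {}")
    case True
    then have "- supp = {}" unfolding eq U(3)[symmetric] by simp
    then show ?thesis by (simp only: E_empty)
  next
    case False
    then have r: "range (from_nat_into \<U>) = \<U>" using U(2) by (simp add: range_from_nat_into)
    then have n: "from_nat_into \<U> n \<in> {U. open U \<and> E U = (\<lambda>x. 0)}" for n using U(1) by auto
    have "E (\<Union>n. from_nat_into \<U> n) x = 0"
    proof (rule E_null_UN)
      show "E (from_nat_into \<U> n) x = 0" for n x using n[of n] by simp
      show "range (from_nat_into \<U>) \<subseteq> sets borel" using n by auto
    qed
    then show ?thesis unfolding eq U(3)[symmetric] r by simp
  qed
qed

lemma E_supp: "E supp x = x"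
  using E_Un_disjoint[of supp "- supp" x] by (simp add: E_Compl_supp)

lemma calc_restrict_supp:
  assumes "bounded_borel \<phi>" shows "calc (\<lambda>z. \<phi> z * indicator supp z) x = calc \<phi> x"
  using calc_mult[OF assms bounded_borel_indicator[of supp], of x]
  by (simp add: calc_indicator E_supp)

lemma calc_cong_supp:
  assumes "bounded_borel \<phi>" "bounded_borel \<psi>" "\<And>z. z \<in> supp \<Longrightarrow> \<phi> z = \<psi> z"
  shows "calc \<phi> x = calc \<psi> x"
proof -
  have "(\<lambda>z. \<phi> z * indicator supp z) = (\<lambda>z. \<psi> z * indicator supp z :: complex)"
    using assms(3) by (auto simp: indicator_def)
  then show ?thesis using calc_restrict_supp[OF assms(1), of x] calc_restrict_supp[OF assms(2), of x] by simp
qed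

text \<open>Vectors are recovered from their components in the spectral subspaces of large balls, on
  which the operator is bounded.  Identities between vectors are checked on these components.\<close>

lemma E_cball_tendsto: "(\<lambda>n. E (cball 0 (real n)) x) \<longlonglongrightarrow> x"
proof -
  have "(\<Union>n. cball 0 (real n)) = (UNIV :: complex set)"
    using real_arch_simple by auto
  moreover have "incseq (\<lambda>n. cball (0::complex) (real n))" by (auto simp: incseq_def)
  moreover have "range (\<lambda>n. cball (0::complex) (real n)) \<subseteq> sets borel"
    by (intro image_subsetI borel_closed closed_cball)
  ultimately show ?thesis
    using E_incseq_tendsto[of "\<lambda>n. cball 0 (real n)" x] by (simp only: E_UNIV)
qed

section \<open>Analyticity of operator exponentials\<close>

text \<open>The scalar remainder is at most \<open>\<bar>h\<bar>\<^sup>2 \<bar>l\<bar>\<^sup>2 exp ((\<bar>z\<bar> + \<bar>h\<bar>) \<bar>l\<bar>) \<bar>\<phi>(l)\<bar>\<close>.  Absorbing the two factors \<open>\<bar>l\<bar>\<close> into the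
  exponential costs \<open>2\<close> in the admissible radius.\<close>

lemma calc_exp_remainder:
  assumes \<phi>: "exp_tempered r \<phi>"
  shows "\<exists>C\<ge>0. \<forall>z h x. norm z + norm h \<le> r - 2 \<longrightarrow>
    norm (calc (\<lambda>l. exp ((z + h) * l) * \<phi> l) x - calc (\<lambda>l. exp (z * l) * \<phi> l) x
      - h *\<^sub>C calc (\<lambda>l. l * (exp (z * l) * \<phi> l)) x) \<le> C * (norm h)\<^sup>2 * norm x"
proof -
  obtain B where m: "\<phi> \<in> borel_measurable borel" and B: "\<And>l. exp (r * norm l) * norm (\<phi> l) \<le> B"
    using \<phi> by (auto simp: exp_tempered_def)
  have B0: "B \<ge> 0" by (rule order_trans[OF _ B[of 0]]) simp
  have "norm (calc (\<lambda>l. exp ((z + h) * l) * \<phi> l) x - calc (\<lambda>l. exp (z * l) * \<phi> l) x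
      - h *\<^sub>C calc (\<lambda>l. l * (exp (z * l) * \<phi> l)) x) \<le> (K * B) * (norm h)\<^sup>2 * norm x"
    if zh: "norm z + norm h \<le> r - 2" for z h x
  proof -
    have nzh: "norm (z + h) \<le> r" using norm_triangle_ineq[of z h] zh by linarith
    have nz: "norm z \<le> r" "norm z \<le> r - 1" using norm_ge_zero[of h] zh by linarith+
    note b1 = exp_tempered_bounded_borel(1)[OF \<phi> nzh]
      and b2 = exp_tempered_bounded_borel(1)[OF \<phi> nz(1)]
      and b3 = exp_tempered_bounded_borel(2)[OF \<phi> nz(2)]
    let ?R = "\<lambda>l. exp ((z + h) * l) * \<phi> l - exp (z * l) * \<phi> l - h * (l * (exp (z * l) * \<phi> l))"
    have b4: "bounded_borel (\<lambda>l. h * (l * (exp (z * l) * \<phi> l)))"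
      by (rule bounded_borel_mult[OF bounded_borel_const b3])
    have "norm (?R l) \<le> B * (norm h)\<^sup>2" for l
    proof -
      have "?R l = (exp (h * l) - 1 - h * l) * (exp (z * l) * \<phi> l)"
        by (simp add: exp_add algebra_simps)
      then have "norm (?R l) = norm (exp (h * l) - 1 - h * l) * (norm (exp (z * l)) * norm (\<phi> l))"
        by (simp add: norm_mult)
      also have "\<dots> \<le> (exp (norm (h * l)) * (norm (h * l))\<^sup>2) * (exp (norm (z * l)) * norm (\<phi> l))"
        by (intro mult_mono norm_exp_taylor2 norm_exp) auto
      also have "\<dots> = (norm h)\<^sup>2 * ((norm l)\<^sup>2 * exp ((norm z + norm h) * norm l) * norm (\<phi> l))"
        unfolding distrib_right exp_add by (simp only: norm_mult power_mult_distrib mult_ac)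
      also have "\<dots> \<le> (norm h)\<^sup>2 * (exp (r * norm l) * norm (\<phi> l))"
      proof (intro mult_left_mono mult_right_mono)
        have "norm l \<le> exp (norm l)" using exp_ge_add_one_self[of "norm l"] by linarith
        then have "(norm l)\<^sup>2 \<le> (exp (norm l))\<^sup>2" by (intro power_mono) auto
        then have "(norm l)\<^sup>2 * exp ((norm z + norm h) * norm l)
            \<le> (exp (norm l))\<^sup>2 * exp ((norm z + norm h) * norm l)" by (intro mult_right_mono) auto
        also have "\<dots> = exp ((norm z + norm h + 2) * norm l)"
          by (simp add: power2_eq_square exp_add[symmetric] algebra_simps)
        also have "\<dots> \<le> exp (r * norm l)" using zh by (simp add: mult_right_mono)
        finally show "(norm l)\<^sup>2 * exp ((norm z + norm h) * norm l) \<le> exp (r * norm l)" .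
      qed auto
      also have "\<dots> \<le> (norm h)\<^sup>2 * B" using B by (intro mult_left_mono) auto
      finally show ?thesis by (simp add: mult.commute)
    qed
    then have "norm (calc ?R x) \<le> K * (B * (norm h)\<^sup>2) * norm x"
      by (intro calc_norm bounded_borel_diff b1 b2 b4)
    moreover have "calc ?R x = calc (\<lambda>l. exp ((z + h) * l) * \<phi> l) x - calc (\<lambda>l. exp (z * l) * \<phi> l) x
        - h *\<^sub>C calc (\<lambda>l. l * (exp (z * l) * \<phi> l)) x"
      by (simp only: calc_diff[OF bounded_borel_diff[OF b1 b2] b4] calc_diff[OF b1 b2] calc_cmult[OF b3])
    ultimately show ?thesis by (simp add: mult.assoc)
  qed
  then show ?thesis using B0 K_pos by (intro exI[of _ "K * B"]) auto
qed

lemma calc_exp_has_derivative: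
  assumes \<phi>: "exp_tempered r \<phi>" and z: "norm z < r - 2"
  shows "((\<lambda>z. calc (\<lambda>l. exp (z * l) * \<phi> l) x) has_derivative
    (\<lambda>h. h *\<^sub>C calc (\<lambda>l. l * (exp (z * l) * \<phi> l)) x)) (at z)"
proof -
  obtain C where C: "C \<ge> 0" "\<And>z h x. norm z + norm h \<le> r - 2 \<Longrightarrow>
    norm (calc (\<lambda>l. exp ((z + h) * l) * \<phi> l) x - calc (\<lambda>l. exp (z * l) * \<phi> l) x
      - h *\<^sub>C calc (\<lambda>l. l * (exp (z * l) * \<phi> l)) x) \<le> C * (norm h)\<^sup>2 * norm x"
    using calc_exp_remainder[OF \<phi>] by blast
  show ?thesis
  proof (rule has_derivativeI_sandwich[where e = "r - 2 - norm z" and H = "\<lambda>w. C * norm (w - z) * norm x"])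
    show "bounded_linear (\<lambda>h. h *\<^sub>C calc (\<lambda>l. l * (exp (z * l) * \<phi> l)) x)"
      by (rule scaleC.bounded_linear_left)
    have "((\<lambda>w. C * norm (w - z) * norm x) \<longlongrightarrow> C * norm (z - z) * norm x) (at z)"
      by (intro tendsto_intros)
    then show "((\<lambda>w. C * norm (w - z) * norm x) \<longlongrightarrow> 0) (at z)" by simp
    fix w assume w: "w \<noteq> z" "dist w z < r - 2 - norm z"
    have "norm (calc (\<lambda>l. exp (w * l) * \<phi> l) x - calc (\<lambda>l. exp (z * l) * \<phi> l) x
      - (w - z) *\<^sub>C calc (\<lambda>l. l * (exp (z * l) * \<phi> l)) x) \<le> C * (norm (w - z))\<^sup>2 * norm x"
      using C(2)[of z "w - z" x] w(2) by (simp add: dist_norm)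
    then show "norm (calc (\<lambda>l. exp (w * l) * \<phi> l) x - calc (\<lambda>l. exp (z * l) * \<phi> l) x
      - (w - z) *\<^sub>C calc (\<lambda>l. l * (exp (z * l) * \<phi> l)) x) / norm (w - z) \<le> C * norm (w - z) * norm x"
      using w(1) by (simp add: field_simps power2_eq_square)
  qed (use z in auto)
qed

end

section \<open>Scalar type operators and weak solutions\<close>

text \<open>The spectrum of a scalar type operator is the support of \<open>E\<close>; here it is named through \<open>E\<close>, so that
  everything about the operator is read off from its spectral measure.\<close>

locale scalar_operator = spectral E for E :: "complex set \<Rightarrow> 'a::complex_banach \<Rightarrow> 'a" +
  fixes D :: "'a set" and A :: "'a \<Rightarrow> 'a"
  assumes domain_eq: "D = {f. convergent (\<lambda>n. truncated_spectral_integral E (spectral_support E) n f)}"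
    and operator_limit: "f \<in> D \<Longrightarrow> (\<lambda>n. truncated_spectral_integral E (spectral_support E) n f) \<longlonglongrightarrow> A f"
    and dense: "closure D = UNIV"
begin

abbreviation trunc_id :: "nat \<Rightarrow> complex \<Rightarrow> complex" where
  "trunc_id n \<equiv> (\<lambda>z. if z \<in> supp \<and> cmod z \<le> real n then z else 0)"

lemma truncated_eq: "truncated_spectral_integral E supp n = calc (trunc_id n)"
  by (simp add: truncated_spectral_integral_def)

lemma bounded_borel_trunc_id: "bounded_borel (trunc_id n)"
proof (rule bounded_borelI[where B = "real n"])
  have "(\<lambda>z. if z \<in> supp \<inter> cball 0 (real n) then z else 0 :: complex) \<in> borel_measurable borel"
    by (intro measurable_If_set) auto
  moreover have "(\<lambda>z. if z \<in> supp \<inter> cball 0 (real n) then z else 0) = trunc_id n" by auto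
  ultimately show "trunc_id n \<in> borel_measurable borel" by simp
qed auto

lemma calc_trunc_id:
  assumes "bounded_borel \<phi>" "bounded_borel (\<lambda>z. z * \<phi> z)"
  shows "calc (\<lambda>z. trunc_id n z * \<phi> z) x = E (cball 0 (real n)) (calc (\<lambda>z. z * \<phi> z) x)"
proof -
  have i: "bounded_borel (indicator (cball 0 (real n)))" by (rule bounded_borel_indicator) auto
  have "calc (\<lambda>z. trunc_id n z * \<phi> z) x = calc (\<lambda>z. indicator (cball 0 (real n)) z * (z * \<phi> z)) x"
    by (rule calc_cong_supp[OF bounded_borel_mult[OF bounded_borel_trunc_id assms(1)] bounded_borel_mult[OF i assms(2)]])
      (auto simp: indicator_def)
  also have "\<dots> = E (cball 0 (real n)) (calc (\<lambda>z. z * \<phi> z) x)"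
    by (simp add: calc_mult[OF i assms(2)] calc_indicator)
  finally show ?thesis .
qed

text \<open>The truncations of the operator map \<open>calc \<phi> x\<close> to the ball components of the right-hand side, which
  converge to it.\<close>

lemma operator_calc:
  assumes "bounded_borel \<phi>" "bounded_borel (\<lambda>z. z * \<phi> z)"
  shows "calc \<phi> x \<in> D" "A (calc \<phi> x) = calc (\<lambda>z. z * \<phi> z) x"
proof -
  have "(\<lambda>n. truncated_spectral_integral E supp n (calc \<phi> x)) \<longlonglongrightarrow> calc (\<lambda>z. z * \<phi> z) x"
    unfolding truncated_eq calc_mult[OF bounded_borel_trunc_id assms(1), symmetric] calc_trunc_id[OF assms]
    by (rule E_cball_tendsto)
  moreover from this show "calc \<phi> x \<in> D" unfolding domain_eq by (auto intro: convergentI)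
  ultimately show "A (calc \<phi> x) = calc (\<lambda>z. z * \<phi> z) x" using operator_limit LIMSEQ_unique by blast
qed

lemma calc_operator:
  assumes "bounded_borel \<phi>" "bounded_borel (\<lambda>z. z * \<phi> z)" "f \<in> D"
  shows "calc \<phi> (A f) = calc (\<lambda>z. z * \<phi> z) f"
proof -
  have "(\<lambda>n. calc \<phi> (calc (trunc_id n) f)) \<longlonglongrightarrow> calc \<phi> (A f)"
    using bounded_linear.tendsto[OF calc_bounded_linear[OF assms(1)] operator_limit[OF assms(3)]]
    by (simp add: truncated_eq)
  moreover have "calc \<phi> (calc (trunc_id n) f) = E (cball 0 (real n)) (calc (\<lambda>z. z * \<phi> z) f)" for n
  proof -
    have eq: "(\<lambda>z. \<phi> z * trunc_id n z) = (\<lambda>z. trunc_id n z * \<phi> z)" by (intro ext mult.commute)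
    show ?thesis
      by (rule trans[OF sym[OF calc_mult[OF assms(1) bounded_borel_trunc_id, of n f, unfolded eq]]
            calc_trunc_id[OF assms(1,2), of n f]])
  qed
  ultimately have "(\<lambda>n. E (cball 0 (real n)) (calc (\<lambda>z. z * \<phi> z) f)) \<longlonglongrightarrow> calc \<phi> (A f)" by simp
  then show ?thesis using E_cball_tendsto by (rule LIMSEQ_unique)
qed

lemma op_adjoint_eq:
  assumes "bounded_clinear h" "\<And>f. f \<in> D \<Longrightarrow> g (A f) = h f"
  shows "op_adjoint D A g = h"
  unfolding op_adjoint_def
proof (rule the_equality)
  show "bounded_clinear h \<and> (\<forall>f\<in>D. g (A f) = h f)" using assms by blast
next
  fix k assume k: "bounded_clinear k \<and> (\<forall>f\<in>D. g (A f) = k f)"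
  then have "bounded_linear k" "bounded_linear h"
    using assms(1) bounded_clinear_bounded_linear by auto
  then have "closed {x. k x = h x}"
    by (intro closed_Collect_eq linear_continuous_on)
  moreover have "D \<subseteq> {x. k x = h x}" using k assms(2) by auto
  ultimately have "closure D \<subseteq> {x. k x = h x}" by (rule closure_minimal[rotated])
  then show "k = h" using dense by auto
qed

lemma op_adjoint_props:
  assumes "g \<in> adjoint_domain D A"
  shows "bounded_clinear g" "bounded_clinear (op_adjoint D A g)" "f \<in> D \<Longrightarrow> g (A f) = op_adjoint D A g f"
proof -
  obtain h where h: "bounded_clinear h" "\<forall>f\<in>D. g (A f) = h f" and "bounded_clinear g"
    using assms by (auto simp: adjoint_domain_def)
  then show "bounded_clinear g" by simp
  have "op_adjoint D A g = h" using h by (intro op_adjoint_eq) auto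
  then show "bounded_clinear (op_adjoint D A g)" "f \<in> D \<Longrightarrow> g (A f) = op_adjoint D A g f"
    using h by auto
qed

text \<open>Composition with such an operator turns every functional into an admissible test functional, so that
  all functionals see the components of a weak solution in bounded spectral subspaces.\<close>

lemma calc_functional_adjoint:
  assumes "bounded_clinear g" "bounded_borel \<phi>" "bounded_borel (\<lambda>z. z * \<phi> z)"
  shows "(\<lambda>x. g (calc \<phi> x)) \<in> adjoint_domain D A"
    "op_adjoint D A (\<lambda>x. g (calc \<phi> x)) = (\<lambda>x. g (calc (\<lambda>z. z * \<phi> z) x))"
proof -
  have 1: "bounded_clinear (\<lambda>x. g (calc \<phi> x))" "bounded_clinear (\<lambda>x. g (calc (\<lambda>z. z * \<phi> z) x))"
    by (rule bounded_clinear_compose[OF assms(1) calc_bounded_clinear], fact)+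
  have 2: "g (calc \<phi> (A f)) = g (calc (\<lambda>z. z * \<phi> z) f)" if "f \<in> D" for f
    using calc_operator[OF assms(2,3) that] by simp
  show "(\<lambda>x. g (calc \<phi> x)) \<in> adjoint_domain D A"
    unfolding adjoint_domain_def using 1 2 by blast
  show "op_adjoint D A (\<lambda>x. g (calc \<phi> x)) = (\<lambda>x. g (calc (\<lambda>z. z * \<phi> z) x))"
    by (rule op_adjoint_eq[OF 1(2)]) (rule 2)
qed

text \<open>Uniqueness on the spectral subspace of a bounded set: tested with any functional,
  \<open>exp ((t - s) A) y(s)\<close>, cut off to that subspace, has derivative \<open>0\<close> in \<open>s\<close>, because the derivatives
  of the two factors cancel; its values at \<open>s = 0\<close> and \<open>s = t\<close> are compared.\<close>

lemma weak_solution_truncated: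
  fixes n :: nat
  assumes y: "weak_solution D A y" and t: "t \<ge> 0"
  defines "\<kappa> \<equiv> (indicator (cball 0 (real n)) :: complex \<Rightarrow> complex)"
  shows "calc \<kappa> (y t) = calc (\<lambda>l. exp (of_real t * l) * \<kappa> l) (y 0)"
proof (rule ccontr)
  assume ne: "\<not> ?thesis"
  define r where "r = t + 3"
  have \<kappa>: "exp_tempered r \<kappa>"
    unfolding \<kappa>_def r_def using t by (intro exp_tempered_indicator[where R = "real n"]) auto
  obtain C where C: "C \<ge> 0" "\<And>z h x. norm z + norm h \<le> r - 2 \<Longrightarrow>
    norm (calc (\<lambda>l. exp ((z + h) * l) * \<kappa> l) x - calc (\<lambda>l. exp (z * l) * \<kappa> l) x
      - h *\<^sub>C calc (\<lambda>l. l * (exp (z * l) * \<kappa> l)) x) \<le> C * (norm h)\<^sup>2 * norm x"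
    using calc_exp_remainder[OF \<kappa>] by blast
  (* G s is e^((t - s) A) cut off to the ball, and - G' s its derivative in s *)
  define G where "G s = calc (\<lambda>l. exp (of_real (t - s) * l) * \<kappa> l)" for s
  define G' where "G' s = calc (\<lambda>l. l * (exp (of_real (t - s) * l) * \<kappa> l))" for s
  have "calc \<kappa> (y t) - calc (\<lambda>l. exp (of_real t * l) * \<kappa> l) (y 0) \<noteq> 0" using ne by simp
  then obtain g :: "'a \<Rightarrow> complex" where g: "bounded_clinear g"
    "g (calc \<kappa> (y t) - calc (\<lambda>l. exp (of_real t * l) * \<kappa> l) (y 0)) \<noteq> 0"
    by (rule functional_nonzero_at)
  interpret g: bounded_linear g by (rule bounded_clinear_bounded_linear[OF g(1)])
  obtain L where L: "L > 0" "\<And>x. norm (g x) \<le> norm x * L" using g.pos_bounded by blast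
  have cont: "(y \<longlongrightarrow> y s) (at s within {0..t})" if s: "s \<in> {0..t}" for s
  proof -
    have "continuous_on {0..t} y"
      using y by (auto simp: weak_solution_def intro: continuous_on_subset)
    then show ?thesis using s by (simp add: continuous_on_def)
  qed
  have nts: "norm (complex_of_real (t - s)) \<le> r" "norm (complex_of_real (t - s)) \<le> r - 1"
    if "s \<in> {0..t}" for s
    using that unfolding norm_of_real by (auto simp: r_def)
  have "((\<lambda>u. g (G u (y u))) has_vector_derivative 0) (at s within {0..t})" if s: "s \<in> {0..t}" for s
  proof -
    note bb = exp_tempered_bounded_borel(1)[OF \<kappa> nts(1)[OF s]] exp_tempered_bounded_borel(2)[OF \<kappa> nts(2)[OF s]]
    have G'l: "bounded_linear (G' s)" unfolding G'_def by (intro calc_bounded_linear bb)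
    (* y is differentiable only against functionals, so the product rule is done by hand:
       R u is the second order error of u -> G u, applied to the moving vector y u *)
    define R where "R u = G u (y u) - G s (y u) - (complex_of_real (s - u)) *\<^sub>C G' s (y u)" for u
    have Rb: "norm (R u) \<le> C * (u - s)\<^sup>2 * norm (y u)" if u: "u \<in> {0..t}" "dist u s < 1" for u
    proof -
      have *: "complex_of_real (t - s) + complex_of_real (s - u) = complex_of_real (t - u)" by simp
      have "norm (complex_of_real (t - s)) + norm (complex_of_real (s - u)) \<le> r - 2"
        using s u unfolding norm_of_real by (auto simp: r_def dist_real_def)
      from C(2)[OF this, of "y u", unfolded *]
      show ?thesis unfolding R_def G_def G'_def norm_of_real by (simp add: power2_commute)
    qed
    have d1: "((\<lambda>u. g (R u)) has_vector_derivative 0) (at s within {0..t})"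
      unfolding has_vector_derivative_def
    proof (rule has_derivativeI_sandwich[where e = 1 and H = "\<lambda>u. L * C * \<bar>u - s\<bar> * norm (y u)"])
      show "bounded_linear (\<lambda>x::real. x *\<^sub>R (0::complex))" by simp
      have "((\<lambda>u. L * C * \<bar>u - s\<bar> * norm (y u)) \<longlongrightarrow> L * C * \<bar>s - s\<bar> * norm (y s)) (at s within {0..t})"
        by (intro tendsto_intros cont s)
      then show "((\<lambda>u. L * C * \<bar>u - s\<bar> * norm (y u)) \<longlongrightarrow> 0) (at s within {0..t})" by simp
      fix u assume u: "u \<in> {0..t}" "u \<noteq> s" "dist u s < 1"
      have "R s = 0" by (simp add: R_def scaleC.zero_left)
      then have "norm (g (R u) - g (R s) - (u - s) *\<^sub>R 0) \<le> norm (R u) * L" using L(2) by (simp add: g.zero)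
      also have "\<dots> \<le> C * (u - s)\<^sup>2 * norm (y u) * L"
        using Rb[OF u(1,3)] L(1) by (intro mult_right_mono) auto
      finally have "norm (g (R u) - g (R s) - (u - s) *\<^sub>R 0) / norm (u - s)
          \<le> C * (u - s)\<^sup>2 * norm (y u) * L / norm (u - s)" by (rule divide_right_mono) simp
      also have "\<dots> = L * C * \<bar>u - s\<bar> * norm (y u)"
      proof -
        have sq: "(u - s)\<^sup>2 = \<bar>u - s\<bar> * \<bar>u - s\<bar>" by (simp add: power2_eq_square)
        have *: "C * (a * a) * b * L / a = L * C * a * b" if "a \<noteq> 0" for a b :: real
          using that by simp
        show ?thesis unfolding sq real_norm_def by (rule *) (use u in simp)
      qed
      finally show "norm (g (R u) - g (R s) - (u - s) *\<^sub>R 0) / norm (u - s) \<le> L * C * \<bar>u - s\<bar> * norm (y u)" .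
    qed simp
    have d2: "((\<lambda>u. (u - s) *\<^sub>R g (G' s (y u))) has_vector_derivative g (G' s (y s))) (at s within {0..t})"
      unfolding has_vector_derivative_def
    proof (rule has_derivativeI_sandwich[where e = 1 and H = "\<lambda>u. norm (g (G' s (y u)) - g (G' s (y s)))"])
      show "bounded_linear (\<lambda>x. x *\<^sub>R g (G' s (y s)))" by (rule bounded_linear_scaleR_left)
      have "((\<lambda>u. norm (g (G' s (y u)) - g (G' s (y s)))) \<longlongrightarrow> norm (g (G' s (y s)) - g (G' s (y s)))) (at s within {0..t})"
        by (intro tendsto_intros g.tendsto bounded_linear.tendsto[OF G'l] cont s)
      then show "((\<lambda>u. norm (g (G' s (y u)) - g (G' s (y s)))) \<longlongrightarrow> 0) (at s within {0..t})" by simp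
      fix u assume u: "u \<in> {0..t}" "u \<noteq> s" "dist u s < 1"
      have "(u - s) *\<^sub>R g (G' s (y u)) - (s - s) *\<^sub>R g (G' s (y s)) - (u - s) *\<^sub>R g (G' s (y s))
          = (u - s) *\<^sub>R (g (G' s (y u)) - g (G' s (y s)))" by (simp add: scaleR_diff_right)
      then show "norm ((u - s) *\<^sub>R g (G' s (y u)) - (s - s) *\<^sub>R g (G' s (y s)) - (u - s) *\<^sub>R g (G' s (y s))) / norm (u - s)
          \<le> norm (g (G' s (y u)) - g (G' s (y s)))" using u by simp
    qed simp
    have d3: "((\<lambda>u. g (G s (y u))) has_vector_derivative g (G' s (y s))) (at s within {0..t})"
    proof -
      have "(\<lambda>x. g (G s x)) \<in> adjoint_domain D A"
        "op_adjoint D A (\<lambda>x. g (G s x)) = (\<lambda>x. g (G' s x))"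
        unfolding G_def G'_def by (rule calc_functional_adjoint[OF g(1) bb])+
      then have "((\<lambda>u. g (G s (y u))) has_vector_derivative g (G' s (y s))) (at s within {0..})"
        using y s by (auto simp: weak_solution_def dest!: bspec)
      then show ?thesis by (rule has_vector_derivative_within_subset) auto
    qed
    have "((\<lambda>u. (g (R u) - (u - s) *\<^sub>R g (G' s (y u))) + g (G s (y u))) has_vector_derivative
        (0 - g (G' s (y s))) + g (G' s (y s))) (at s within {0..t})"
      by (intro has_vector_derivative_add has_vector_derivative_diff d1 d2 d3)
    moreover have "(g (R u) - (u - s) *\<^sub>R g (G' s (y u))) + g (G s (y u)) = g (G u (y u))" for u
      by (simp add: R_def g.diff g.add scaleC_of_real g.scaleR algebra_simps del: of_real_diff)
    ultimately show ?thesis by simp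
  qed
  then obtain c where c: "\<And>s. s \<in> {0..t} \<Longrightarrow> g (G s (y s)) = c"
    by (rule has_vector_derivative_zero_constant[OF convex_real_interval(5)]) auto
  have "g (G t (y t)) = g (G 0 (y 0))" using c[of t] c[of 0] t by simp
  then show False using g(2) by (simp add: G_def g.diff)
qed

section \<open>Spectral growth condition implies entirety\<close>

text \<open>On the spectrum \<open>r \<bar>l\<bar> - r C Re l\<close> is bounded above: for \<open>Re l \<ge> 0\<close> by the growth condition, and the points
  with \<open>Re l < 0\<close> all lie in the disk of radius \<open>C\<close>.\<close>

lemma exp_tempered_of_spectral_growth:
  assumes C: "C \<ge> 0" "\<And>l. l \<in> supp \<Longrightarrow> norm l \<le> C * (1 + max 0 (Re l))" and r: "r \<ge> 0"
  shows "exp_tempered r (\<lambda>l. exp (- of_real (r * C) * l) * indicator supp l)"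
  unfolding exp_tempered_def
proof (intro conjI exI[of _ "exp (r * C + r * C * C)"] allI)
  show "(\<lambda>l. exp (- of_real (r * C) * l) * indicator supp l) \<in> borel_measurable borel"
    by measurable
  fix l :: complex
  have "r * norm l - r * C * Re l \<le> r * C + r * C * C" if "l \<in> supp"
  proof (cases "Re l \<ge> 0")
    case True
    then have "r * norm l \<le> r * (C * (1 + Re l))" using C(2)[OF that] r by (intro mult_left_mono) auto
    moreover have "r * C * C \<ge> 0" using r C(1) by simp
    ultimately show ?thesis by (simp add: algebra_simps)
  next
    case False
    then have l: "norm l \<le> C" using C(2)[OF that] by simp
    have "- Re l \<le> C" using abs_Re_le_cmod[of l] l by linarith
    then have "(r * C) * (- Re l) \<le> (r * C) * C" using r C(1) by (intro mult_left_mono) auto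
    moreover have "r * norm l \<le> r * C" using l r by (rule mult_left_mono)
    ultimately show ?thesis by simp
  qed
  then show "exp (r * norm l) * norm (exp (- of_real (r * C) * l) * indicator supp l)
      \<le> exp (r * C + r * C * C)"
    by (auto simp: indicator_def norm_mult exp_add[symmetric])
qed

text \<open>For \<open>\<bar>z\<bar> \<le> r\<close> the continuation is \<open>exp ((z - t) A) y(t)\<close> with a time \<open>t\<close> that depends on \<open>r\<close>.  The pieces for different
  \<open>r\<close> fit together because their components in the spectral subspaces of balls are \<open>exp (z A) y(0)\<close>, cut off,
  for every choice of \<open>r\<close>.\<close>

lemma entire_of_spectral_growth:
  assumes C: "C \<ge> 0" "\<And>l. l \<in> supp \<Longrightarrow> norm l \<le> C * (1 + max 0 (Re l))"
    and y: "weak_solution D A y"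
  shows "entire_vector_function y"
proof -
  define \<kappa> where "\<kappa> n = (indicator (cball 0 (real n)) :: complex \<Rightarrow> complex)" for n
  have \<kappa>: "exp_tempered r (\<kappa> n)" if "r \<ge> 0" for r n
    unfolding \<kappa>_def using that by (intro exp_tempered_indicator) auto
  have \<kappa>E: "calc (\<kappa> n) x = E (cball 0 (real n)) x" for n x
    unfolding \<kappa>_def by (rule calc_indicator) auto
  have \<kappa>b: "bounded_borel (\<kappa> n)" for n
    unfolding \<kappa>_def by (rule bounded_borel_indicator) auto
  have \<kappa>\<kappa>: "\<kappa> n l * \<kappa> n l = \<kappa> n l" for n l by (simp add: \<kappa>_def indicator_def)
  define Yn where "Yn n z = calc (\<lambda>l. exp (z * l) * \<kappa> n l) (y 0)" for n z
  define Y where "Y z = lim (\<lambda>n. Yn n z)" for z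
  (* the 2 pays for the loss of radius in calc_exp_has_derivative *)
  define t where "t r = (r + 2) * C" for r
  define \<phi> where "\<phi> r l = exp (- of_real (t r) * l) * indicator supp l" for r l
  define Yr where "Yr r z = calc (\<lambda>l. exp (z * l) * \<phi> r l) (y (t r))" for r z
  have \<phi>: "exp_tempered (r + 2) (\<phi> r)" if "r \<ge> 0" for r
    unfolding \<phi>_def t_def using that by (intro exp_tempered_of_spectral_growth C) auto
  have loc: "calc (\<kappa> n) (Yr r z) = Yn n z" if r: "norm z \<le> r" for n r z
  proof -
    have r0: "r \<ge> 0" using r norm_ge_zero[of z] by linarith
    have t0: "t r \<ge> 0" using r0 C(1) by (simp add: t_def)
    let ?w = "z - of_real (t r)"
    have b1: "bounded_borel (\<lambda>l. exp (z * l) * \<phi> r l)"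
      using r by (intro exp_tempered_bounded_borel(1)[OF \<phi>[OF r0]]) auto
    have b2: "bounded_borel (\<lambda>l. exp (w * l) * \<kappa> n l)" for w
      by (rule exp_tempered_bounded_borel(1)[OF \<kappa>[of "norm w"]]) auto
    have "calc (\<kappa> n) (Yr r z) = calc (\<lambda>l. \<kappa> n l * (exp (z * l) * \<phi> r l)) (y (t r))"
      unfolding Yr_def by (rule calc_mult[OF \<kappa>b b1, symmetric])
    also have "\<dots> = calc (\<lambda>l. exp (?w * l) * \<kappa> n l * \<kappa> n l) (y (t r))"
    proof (rule calc_cong_supp[OF bounded_borel_mult[OF \<kappa>b b1] bounded_borel_mult[OF b2 \<kappa>b]])
      fix l assume l: "l \<in> supp"
      have "exp (?w * l) = exp (z * l) * exp (- of_real (t r) * l)"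
        unfolding exp_add[symmetric] by (simp add: algebra_simps)
      then show "\<kappa> n l * (exp (z * l) * \<phi> r l) = exp (?w * l) * \<kappa> n l * \<kappa> n l"
        using l by (simp add: \<phi>_def \<kappa>\<kappa> mult.assoc)
    qed
    also have "\<dots> = calc (\<lambda>l. exp (?w * l) * \<kappa> n l) (calc (\<kappa> n) (y (t r)))"
      by (rule calc_mult[OF b2 \<kappa>b])
    also have "calc (\<kappa> n) (y (t r)) = calc (\<lambda>l. exp (of_real (t r) * l) * \<kappa> n l) (y 0)"
      unfolding \<kappa>_def by (rule weak_solution_truncated[OF y t0])
    also have "calc (\<lambda>l. exp (?w * l) * \<kappa> n l) \<dots>
        = calc (\<lambda>l. (exp (?w * l) * \<kappa> n l) * (exp (of_real (t r) * l) * \<kappa> n l)) (y 0)"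
      by (rule calc_mult[OF b2 b2, symmetric])
    also have "(\<lambda>l. (exp (?w * l) * \<kappa> n l) * (exp (of_real (t r) * l) * \<kappa> n l)) = (\<lambda>l. exp (z * l) * \<kappa> n l)"
    proof
      fix l
      have "exp (z * l) = exp (?w * l) * exp (of_real (t r) * l)"
        unfolding exp_add[symmetric] by (simp add: algebra_simps)
      then show "(exp (?w * l) * \<kappa> n l) * (exp (of_real (t r) * l) * \<kappa> n l) = exp (z * l) * \<kappa> n l"
        using \<kappa>\<kappa>[of n l] by (simp add: mult.assoc mult.left_commute)
    qed
    finally show ?thesis by (simp add: Yn_def)
  qed
  have YYr: "Y z = Yr r z" if "norm z \<le> r" for r z
  proof -
    have "(\<lambda>n. Yn n z) \<longlonglongrightarrow> Yr r z"
      using E_cball_tendsto[of "Yr r z"] by (simp add: loc[OF that, symmetric] \<kappa>E)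
    then show ?thesis unfolding Y_def by (rule limI)
  qed
  have "vector_analytic_on Y UNIV"
    unfolding vector_analytic_on_def
  proof (intro conjI ballI)
    fix z :: complex
    let ?r = "norm z + 1"
    let ?d = "calc (\<lambda>l. l * (exp (z * l) * \<phi> ?r l)) (y (t ?r))"
    have "((\<lambda>z. Yr ?r z) has_derivative (\<lambda>h. h *\<^sub>C ?d)) (at z)"
      unfolding Yr_def by (rule calc_exp_has_derivative[OF \<phi>]) auto
    then have "(Y has_derivative (\<lambda>h. h *\<^sub>C ?d)) (at z)"
    proof (rule has_derivative_transform_within_open)
      show "open (ball 0 ?r)" "z \<in> ball 0 ?r" by auto
      show "Yr ?r w = Y w" if "w \<in> ball 0 ?r" for w using that YYr[of w ?r] by simp
    qed
    then show "\<exists>d. (Y has_derivative (\<lambda>h. h *\<^sub>C d)) (at z)" by blast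
  qed simp
  moreover have "Y (of_real s) = y s" if s: "s \<ge> 0" for s
  proof -
    have "(\<lambda>n. calc (\<kappa> n) (y s)) \<longlonglongrightarrow> y s" unfolding \<kappa>E by (rule E_cball_tendsto)
    moreover have "calc (\<kappa> n) (y s) = Yn n (of_real s)" for n
      unfolding \<kappa>_def Yn_def by (rule weak_solution_truncated[OF y s])
    ultimately show ?thesis unfolding Y_def by (simp add: limI)
  qed
  ultimately show ?thesis unfolding entire_vector_function_def by blast
qed

section \<open>A solution with no analytic continuation\<close>

text \<open>Exponential orbits in the spectral subspaces of bounded sets may be superposed to a weak
  solution as soon as the series is dominated on each compact time interval by a convergent one.\<close>

lemma weak_solution_series:
  fixes \<Delta> :: "nat \<Rightarrow> complex set" and w :: "nat \<Rightarrow> 'a"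
  assumes \<Delta>: "\<And>k. \<Delta> k \<in> sets borel" "\<And>k. bounded (\<Delta> k)"
    and M: "\<And>T. T \<ge> 0 \<Longrightarrow> \<exists>M. summable M \<and>
      (\<forall>k. \<forall>t\<in>{0..T}. norm (calc (\<lambda>l. exp (of_real t * l) * indicator (\<Delta> k) l) (w k)) \<le> M k)"
  defines "u \<equiv> (\<lambda>k t. calc (\<lambda>l. exp (complex_of_real t * l) * indicator (\<Delta> k) l) (w k))"
  shows "weak_solution D A (\<lambda>t. \<Sum>k. u k t)" "t \<ge> 0 \<Longrightarrow> (\<lambda>k. u k t) sums (\<Sum>k. u k t)"
proof -
  define y where "y t = (\<Sum>k. u k t)" for t
  have temp: "exp_tempered r (indicator (\<Delta> k))" if r: "r \<ge> 0" for r k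
  proof -
    obtain R where "\<forall>x\<in>\<Delta> k. norm x \<le> R" using \<Delta>(2)[of k] unfolding bounded_iff by blast
    then have "\<Delta> k \<subseteq> cball 0 R" by auto
    then show ?thesis by (rule exp_tempered_indicator[OF \<Delta>(1) _ r])
  qed
  have b1: "bounded_borel (\<lambda>l. exp (z * l) * indicator (\<Delta> k) l)" for z k
    by (rule exp_tempered_bounded_borel(1)[OF temp[of "norm z"]]) auto
  have b2: "bounded_borel (\<lambda>l. l * (exp (z * l) * indicator (\<Delta> k) l))" for z k
    by (rule exp_tempered_bounded_borel(2)[OF temp[of "norm z + 1"]]) auto
  have uD: "u k t \<in> D" and Au: "A (u k t) = calc (\<lambda>l. l * (exp (of_real t * l) * indicator (\<Delta> k) l)) (w k)" for k t
    unfolding u_def by (rule operator_calc[OF b1 b2])+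
  have du: "(u k has_vector_derivative A (u k t)) (at t within S)" for k t S
  proof -
    have "((\<lambda>z. calc (\<lambda>l. exp (z * l) * indicator (\<Delta> k) l) (w k)) has_derivative
        (\<lambda>h. h *\<^sub>C calc (\<lambda>l. l * (exp (of_real t * l) * indicator (\<Delta> k) l)) (w k))) (at (complex_of_real t))"
      by (rule calc_exp_has_derivative[OF temp[of "\<bar>t\<bar> + 3"]]) auto
    from has_derivative_compose[OF has_derivative_of_real[OF has_derivative_ident] this, where s = UNIV]
    have "(u k has_derivative (\<lambda>h. of_real h *\<^sub>C A (u k t))) (at t)"
      unfolding Au unfolding u_def .
    then show ?thesis
      unfolding has_vector_derivative_def scaleC_of_real by (rule has_derivative_at_withinI)
  qed
  have ul: "uniform_limit {0..T} (\<lambda>n t. \<Sum>k<n. u k t) y sequentially" if T: "T \<ge> 0" for T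
  proof -
    obtain N where N: "summable N" "\<And>k t. t \<in> {0..T} \<Longrightarrow> norm (u k t) \<le> N k"
      using M[OF T] unfolding u_def by blast
    show ?thesis unfolding y_def[abs_def] by (rule Weierstrass_m_test[OF N(2) N(1)])
  qed
  have sums: "(\<lambda>k. u k t) sums y t" if "t \<ge> 0" for t
    unfolding sums_def by (rule tendsto_uniform_limitI[OF ul[of t]]) (use that in auto)
  then show "t \<ge> 0 \<Longrightarrow> (\<lambda>k. u k t) sums (\<Sum>k. u k t)" for t by (simp add: y_def)
  have at_eq: "at t within {0..} = at t within {0..t + 1}" if "t \<ge> 0" for t :: real
    by (rule at_within_nhd[of t "{..<t + 1}"]) (use that in auto)
  have "continuous_on {0..} y"
    unfolding continuous_on_eq_continuous_within
  proof
    fix t :: real assume t: "t \<in> {0..}"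
    have "continuous_on {0..t + 1} y"
    proof (rule uniform_limit_theorem[OF _ ul])
      show "\<forall>\<^sub>F n in sequentially. continuous_on {0..t + 1} (\<lambda>t. \<Sum>k<n. u k t)"
        by (intro always_eventually allI continuous_on_sum continuous_on_vector_derivative[OF du])
    qed (use t in auto)
    then have "continuous (at t within {0..t + 1}) y" using t by (simp add: continuous_on_eq_continuous_within)
    then show "continuous (at t within {0..}) y" using t at_eq[of t] by simp
  qed
  moreover have "((\<lambda>s. g (y s)) has_vector_derivative op_adjoint D A g (y t)) (at t within {0..})"
    if g: "g \<in> adjoint_domain D A" and t: "t \<ge> 0" for g t
  proof -
    let ?h = "op_adjoint D A g"
    interpret g: bounded_linear g by (rule bounded_clinear_bounded_linear[OF op_adjoint_props(1)[OF g]])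
    interpret h: bounded_linear ?h by (rule bounded_clinear_bounded_linear[OF op_adjoint_props(2)[OF g]])
    obtain L where L: "L > 0" "\<And>x. norm (?h x) \<le> norm x * L" using h.pos_bounded by blast
    have "\<exists>G. \<forall>s\<in>{0..t + 1}. (\<lambda>k. g (u k s)) sums G s \<and>
        (G has_derivative (\<lambda>r. r *\<^sub>R ?h (y s))) (at s within {0..t + 1})"
    proof (rule has_derivative_series)
      show "convex {0..t + 1}" by simp
      show "t \<in> {0..t + 1}" using t by simp
      show "(\<lambda>k. g (u k t)) sums g (y t)" by (rule g.sums[OF sums[OF t]])
      show "((\<lambda>s. g (u k s)) has_derivative (\<lambda>r. r *\<^sub>R ?h (u k s))) (at s within {0..t + 1})" for k s
        using g.has_vector_derivative[OF du[of k s "{0..t + 1}"]] op_adjoint_props(3)[OF g uD[of k s]]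
        by (simp add: has_vector_derivative_def)
      fix e :: real assume e: "e > 0"
      have "\<forall>\<^sub>F n in sequentially. \<forall>s\<in>{0..t + 1}. dist (\<Sum>k<n. u k s) (y s) < e / L"
        using uniform_limitD[OF ul[of "t + 1"]] t e L(1) by simp
      then show "\<forall>\<^sub>F n in sequentially. \<forall>s\<in>{0..t + 1}. \<forall>r.
          norm ((\<Sum>k<n. r *\<^sub>R ?h (u k s)) - r *\<^sub>R ?h (y s)) \<le> e * norm r"
      proof (eventually_elim, intro ballI allI)
        fix n s and r :: real
        assume elim: "\<forall>s\<in>{0..t + 1}. dist (\<Sum>k<n. u k s) (y s) < e / L" and s: "s \<in> {0..t + 1}"
        have "(\<Sum>k<n. r *\<^sub>R ?h (u k s)) - r *\<^sub>R ?h (y s) = r *\<^sub>R ?h ((\<Sum>k<n. u k s) - y s)"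
          by (simp add: h.diff h.sum scaleR_diff_right scaleR_right.sum)
        also have "norm \<dots> \<le> \<bar>r\<bar> * (norm ((\<Sum>k<n. u k s) - y s) * L)"
          unfolding norm_scaleR by (intro mult_left_mono L) auto
        also have "\<dots> \<le> \<bar>r\<bar> * (e / L * L)"
          using elim s L(1) by (intro mult_left_mono mult_right_mono) (auto simp: dist_norm intro: less_imp_le)
        finally show "norm ((\<Sum>k<n. r *\<^sub>R ?h (u k s)) - r *\<^sub>R ?h (y s)) \<le> e * norm r"
          using L(1) by (simp add: mult.commute)
      qed
    qed
    then obtain G where G: "\<And>s. s \<in> {0..t + 1} \<Longrightarrow> (\<lambda>k. g (u k s)) sums G s"
      "\<And>s. s \<in> {0..t + 1} \<Longrightarrow> (G has_derivative (\<lambda>r. r *\<^sub>R ?h (y s))) (at s within {0..t + 1})" by blast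
    have "G s = g (y s)" if "s \<in> {0..t + 1}" for s
      using G(1)[OF that] g.sums[OF sums[of s]] that by (auto intro: sums_unique2)
    then have "((\<lambda>s. g (y s)) has_derivative (\<lambda>r. r *\<^sub>R ?h (y t))) (at t within {0..t + 1})"
      using t by (intro has_derivative_transform[OF _ _ G(2)]) auto
    then show ?thesis unfolding has_vector_derivative_def at_eq[OF t] .
  qed
  ultimately have "weak_solution D A y" unfolding weak_solution_def by blast
  then show "weak_solution D A (\<lambda>t. \<Sum>k. u k t)" by (simp add: y_def[abs_def])
qed

text \<open>Spacing the moduli by more than \<open>2\<close> makes the unit disks around the points disjoint.\<close>

lemma sparse_spectral_sequence:
  assumes "\<And>C. C \<ge> 0 \<Longrightarrow> \<exists>l\<in>supp. norm l > C * (1 + max 0 (Re l))"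
  obtains \<mu> :: "nat \<Rightarrow> complex" where "\<And>n. \<mu> n \<in> supp"
    "\<And>n. norm (\<mu> n) > (real n)\<^sup>2 * (1 + max 0 (Re (\<mu> n)))"
    "\<And>m n. m < n \<Longrightarrow> norm (\<mu> m) + 2 < norm (\<mu> n)"
proof -
  let ?P = "\<lambda>n l. l \<in> supp \<and> norm l > (real n)\<^sup>2 * (1 + max 0 (Re l))"
  have "\<exists>\<mu>. \<forall>n. ?P n (\<mu> n) \<and> norm (\<mu> n) + 2 < norm (\<mu> (Suc n))"
  proof (rule dependent_nat_choice)
    show "\<exists>l. ?P 0 l" using assms[of 0] by auto
    fix l n assume "?P n l"
    define m where "m = Suc n + nat \<lceil>norm l + 2\<rceil>"
    have m: "real (Suc n) \<le> real m" "norm l + 2 \<le> real m" "real m \<ge> 1"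
      unfolding m_def by linarith+
    obtain l' where l': "l' \<in> supp" "norm l' > (real m)\<^sup>2 * (1 + max 0 (Re l'))"
      using assms[of "(real m)\<^sup>2"] by auto
    have "(real (Suc n))\<^sup>2 * (1 + max 0 (Re l')) \<le> (real m)\<^sup>2 * (1 + max 0 (Re l'))"
      using m(1) by (intro mult_right_mono power_mono) auto
    moreover have "norm l + 2 < norm l'"
    proof -
      have "real m * 1 \<le> (real m)\<^sup>2 * (1 + max 0 (Re l'))"
        using m(3) by (intro mult_mono) (auto simp: power2_eq_square)
      then show ?thesis using m(2) l'(2) by linarith
    qed
    ultimately show "\<exists>l'. ?P (Suc n) l' \<and> norm l + 2 < norm l'" using l' by (intro exI[of _ l']) linarith
  qed
  then obtain \<mu> where \<mu>: "\<And>n. ?P n (\<mu> n)" and step: "\<And>n. norm (\<mu> n) + 2 < norm (\<mu> (Suc n))" by blast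
  have mono: "norm (\<mu> m) \<le> norm (\<mu> n)" if "m \<le> n" for m n
  proof (rule lift_Suc_mono_le[of "\<lambda>n. norm (\<mu> n)", OF _ that])
    show "norm (\<mu> n) \<le> norm (\<mu> (Suc n))" for n using step[of n] by linarith
  qed
  have "norm (\<mu> m) + 2 < norm (\<mu> n)" if "m < n" for m n
    using step[of m] mono[of "Suc m" n] that by linarith
  then show ?thesis using \<mu> that by blast
qed

lemma spectral_unit_vector:
  assumes "l \<in> supp" "open U" "l \<in> U"
  obtains e where "norm e = 1" "E U e = e"
proof -
  have B: "U \<in> sets borel" using assms(2) by simp
  have "E U \<noteq> (\<lambda>x. 0)" using assms by (auto simp: spectral_support_def)
  then obtain x where x: "E U x \<noteq> 0" by (auto simp: fun_eq_iff)
  define e where "e = (1 / norm (E U x)) *\<^sub>R E U x"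
  have "norm e = 1" using x by (simp add: e_def)
  moreover have "E U e = e"
    by (simp add: e_def linear_scale[OF bounded_linear.linear[OF E_bounded_linear[OF B]]] E_E[OF B B])
  ultimately show ?thesis using that by blast
qed

text \<open>The weights \<open>exp (- n a\<^sub>n)\<close> beat \<open>exp (t a\<^sub>n)\<close> for every fixed \<open>t\<close>, yet they are negligible against
  \<open>exp (r \<bar>\<mu>\<^sub>n\<bar>)\<close>, since \<open>\<bar>\<mu>\<^sub>n\<bar> > n\<^sup>2 a\<^sub>n\<close>.\<close>

lemma exists_noncontinuable_weak_solution:
  assumes "\<And>C. C \<ge> 0 \<Longrightarrow> \<exists>l\<in>supp. norm l > C * (1 + max 0 (Re l))"
  shows "\<exists>y. weak_solution D A y \<and> \<not> analytically_continuable_at_0 y"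
proof -
  obtain \<mu> where \<mu>: "\<And>n. \<mu> n \<in> supp"
    "\<And>n. norm (\<mu> n) > (real n)\<^sup>2 * (1 + max 0 (Re (\<mu> n)))"
    "\<And>m n. m < n \<Longrightarrow> norm (\<mu> m) + 2 < norm (\<mu> n)"
    using sparse_spectral_sequence[OF assms] by blast
  define a where "a n = 1 + max 0 (Re (\<mu> n))" for n
  have a1: "a n \<ge> 1" for n by (simp add: a_def)
  define \<Delta> where "\<Delta> n = ball (\<mu> n) 1" for n
  have \<Delta>B: "\<Delta> n \<in> sets borel" for n by (simp add: \<Delta>_def)
  have \<Delta>b: "bounded (\<Delta> n)" for n by (simp add: \<Delta>_def)
  have disj: "\<Delta> m \<inter> \<Delta> n = {}" if "m \<noteq> n" for m n
  proof -
    have "dist (\<mu> m) (\<mu> n) > 2"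
    proof (cases "m < n")
      case True
      then show ?thesis using \<mu>(3)[OF True] norm_triangle_ineq3[of "\<mu> m" "\<mu> n"] by (simp add: dist_norm)
    next
      case False
      then have "n < m" using that by simp
      then show ?thesis using \<mu>(3)[of n m] norm_triangle_ineq3[of "\<mu> m" "\<mu> n"] by (simp add: dist_norm)
    qed
    then show ?thesis unfolding \<Delta>_def by (intro disjoint_ballI) simp
  qed
  have "\<exists>e. norm e = 1 \<and> E (\<Delta> n) e = e" for n
    using spectral_unit_vector[OF \<mu>(1), of "\<Delta> n"] unfolding \<Delta>_def by (metis centre_in_ball open_ball zero_less_one)
  then obtain e where e: "\<And>n. norm (e n) = 1" "\<And>n. E (\<Delta> n) (e n) = e n" by metis
  define w where "w n = exp (- real n * a n) *\<^sub>R e n" for n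
  have nw: "norm (w n) = exp (- real n * a n)" for n using e(1) by (simp add: w_def)
  have Ew: "E (\<Delta> n) (w n) = w n" for n
    by (simp add: w_def linear_scale[OF bounded_linear.linear[OF E_bounded_linear[OF \<Delta>B]]] e(2))
  have temp: "exp_tempered r (indicator (\<Delta> n))" if "r \<ge> 0" for r n
  proof -
    obtain R where "\<forall>x\<in>\<Delta> n. norm x \<le> R" using \<Delta>b[of n] unfolding bounded_iff by blast
    then have "\<Delta> n \<subseteq> cball 0 R" by auto
    then show ?thesis by (rule exp_tempered_indicator[OF \<Delta>B _ that])
  qed
  have bb: "bounded_borel (\<lambda>l. exp (z * l) * indicator (\<Delta> n) l)" for z n
    by (rule exp_tempered_bounded_borel(1)[OF temp[of "norm z"]]) auto
  have ib: "bounded_borel (indicator (\<Delta> n))" for n by (rule bounded_borel_indicator[OF \<Delta>B])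
  define v where "v n z = calc (\<lambda>l. exp (z * l) * indicator (\<Delta> n) l) (w n)" for n z
  have upper: "norm (v n (of_real t)) \<le> K * exp ((t - real n) * a n)" if t: "t \<ge> 0" for n t
  proof -
    have "norm (exp (of_real t * l) * indicator (\<Delta> n) l) \<le> exp (t * a n)" for l
    proof (cases "l \<in> \<Delta> n")
      case True
      then have "norm (\<mu> n - l) < 1" by (simp add: \<Delta>_def dist_norm)
      then have "Re l \<le> a n" using abs_Re_le_cmod[of "\<mu> n - l"] by (simp add: a_def)
      then show ?thesis using t True by (simp add: mult_left_mono)
    qed simp
    then have "norm (v n (of_real t)) \<le> K * exp (t * a n) * norm (w n)"
      unfolding v_def by (intro calc_norm bb)
    also have "\<dots> = K * exp ((t - real n) * a n)"
      unfolding nw mult.assoc exp_add[symmetric] by (simp add: algebra_simps)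
    finally show ?thesis .
  qed
  define y where "y t = (\<Sum>k. v k (complex_of_real t))" for t
  have ser: "\<exists>M. summable M \<and> (\<forall>k. \<forall>t\<in>{0..T}. norm (v k (complex_of_real t)) \<le> M k)"
    if T: "T \<ge> 0" for T
  proof -
    define M where "M k = K * exp ((T - real k) * a k)" for k
    have "norm (v k (complex_of_real t)) \<le> M k" if "t \<in> {0..T}" for k t
    proof -
      have "norm (v k (of_real t)) \<le> K * exp ((t - real k) * a k)" using that by (intro upper) auto
      also have "\<dots> \<le> M k" unfolding M_def
        using that K_pos a1[of k] by (intro mult_left_mono exp_le_cancel_iff[THEN iffD2] mult_right_mono) auto
      finally show ?thesis .
    qed
    moreover have "summable M"
    proof (rule summable_comparison_test_ev)
      obtain N :: nat where N: "T \<le> real N" using real_arch_simple by blast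
      show "\<forall>\<^sub>F k in sequentially. norm (M k) \<le> K * exp T * exp (- 1) ^ k"
        using eventually_ge_at_top[of N]
      proof eventually_elim
        case (elim k)
        have "(T - real k) * a k \<le> (T - real k) * 1"
          using elim N a1[of k] by (intro mult_left_mono_neg) auto
        then have "M k \<le> K * exp (T - real k)" unfolding M_def using K_pos by simp
        also have "\<dots> = K * exp T * exp (- 1) ^ k"
          by (simp add: exp_diff exp_minus divide_inverse power_inverse exp_of_nat_mult[symmetric])
        finally show ?case unfolding M_def using K_pos by simp
      qed
      show "summable (\<lambda>k. K * exp T * exp (- 1) ^ k)"
        by (intro summable_mult summable_geometric) simp
    qed
    ultimately show ?thesis by blast
  qed
  have ws: "weak_solution D A y"
    unfolding y_def[abs_def] v_def using ser unfolding v_def by (intro weak_solution_series(1) \<Delta>B \<Delta>b)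
  have sums: "(\<lambda>k. v k (of_real t)) sums y t" if "t \<ge> 0" for t
    unfolding y_def v_def using ser that unfolding v_def by (intro weak_solution_series(2) \<Delta>B \<Delta>b)
  have Ev: "E (\<Delta> n) (v k z) = (if k = n then v n z else 0)" for n k z
  proof -
    have "E (\<Delta> n) (v k z) = calc (\<lambda>l. indicator (\<Delta> n) l * (exp (z * l) * indicator (\<Delta> k) l)) (w k)"
      unfolding v_def calc_mult[OF ib bb] calc_indicator[OF \<Delta>B] ..
    also have "(\<lambda>l. indicator (\<Delta> n) l * (exp (z * l) * indicator (\<Delta> k) l))
        = (if k = n then (\<lambda>l. exp (z * l) * indicator (\<Delta> k) l) else (\<lambda>l. 0))"
      using disj[of n k] by (auto simp: fun_eq_iff indicator_def)
    finally show ?thesis by (simp add: v_def calc_const scaleC.zero_left)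
  qed
  have Ey: "E (\<Delta> n) (y t) = v n (of_real t)" if "t \<ge> 0" for n t
  proof -
    have "(\<lambda>k. E (\<Delta> n) (v k (of_real t))) sums E (\<Delta> n) (y t)"
      by (rule bounded_linear.sums[OF E_bounded_linear[OF \<Delta>B] sums[OF that]])
    moreover have "(\<lambda>k. E (\<Delta> n) (v k (of_real t))) sums v n (of_real t)"
      unfolding Ev by (rule sums_single)
    ultimately show ?thesis by (rule sums_unique2)
  qed
  have "\<not> analytically_continuable_at_0 y"
  proof
    assume "analytically_continuable_at_0 y"
    then obtain \<delta> Y where \<delta>: "\<delta> > 0" and Y: "vector_analytic_on Y (ball 0 \<delta>)"
      and Yy: "\<And>t. t \<in> {0..<\<delta>} \<Longrightarrow> Y (complex_of_real t) = y t"
      unfolding analytically_continuable_at_0_def by blast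
    have EY: "E (\<Delta> n) (Y z) = v n z" if z: "z \<in> ball 0 \<delta>" for n z
    proof (rule vector_identity_theorem[OF _ _ _ z])
      show "vector_analytic_on (\<lambda>z. E (\<Delta> n) (Y z)) (ball 0 \<delta>)"
        by (rule vector_analytic_on_bounded_clinear[OF E_bounded_clinear[OF \<Delta>B] Y])
      have "\<exists>d. (v n has_derivative (\<lambda>h. h *\<^sub>C d)) (at z)" for z
        unfolding v_def[abs_def] using calc_exp_has_derivative[OF temp[of "norm z + 3" n], of z "w n"] by auto
      then show "vector_analytic_on (v n) (ball 0 \<delta>)" by (simp add: vector_analytic_on_def)
      show "E (\<Delta> n) (Y (of_real t)) = v n (of_real t)" if "0 \<le> t" "t < \<delta>" for t
        using that Yy[of t] Ey[of t n] by simp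
    qed
    define r where "r = \<delta> / 2"
    have r: "r > 0" "cball 0 r \<subseteq> (ball 0 \<delta> :: complex set)" using \<delta> by (auto simp: r_def)
    have "continuous_on (cball 0 r) Y"
      unfolding continuous_on_eq_continuous_within
      using Y r(2) unfolding vector_analytic_on_def
      by (meson continuous_at_imp_continuous_at_within has_derivative_continuous subsetD)
    then have "bounded (Y ` cball 0 r)" by (intro compact_imp_bounded compact_continuous_image) auto
    then obtain b where b: "\<And>z. z \<in> cball 0 r \<Longrightarrow> norm (Y z) \<le> b"
      unfolding bounded_iff by blast
    have main: "exp (r * norm (\<mu> n) - real n * a n) \<le> K * exp r * (K * b)" if n: "n > 0" for n
    proof -
      (* in this direction z * \<mu> n is the positive number r * norm (\<mu> n) *)
      define z where "z = of_real (r / norm (\<mu> n)) * cnj (\<mu> n)"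
      have "norm (\<mu> n) > 0" using \<mu>(2)[of n] n by (smt (verit) norm_ge_zero zero_le_power2 mult_nonneg_nonneg)
      then have nz: "norm z = r" using r(1) by (simp add: z_def norm_mult norm_divide)
      have zl: "z * \<mu> n = of_real (r * norm (\<mu> n))"
      proof -
        have "z * \<mu> n = of_real (r / norm (\<mu> n)) * (\<mu> n * cnj (\<mu> n))"
          by (simp only: z_def mult_ac)
        also have "\<dots> = of_real (r / norm (\<mu> n) * (norm (\<mu> n))\<^sup>2)"
          by (simp only: complex_norm_square[symmetric] of_real_mult)
        also have "r / norm (\<mu> n) * (norm (\<mu> n))\<^sup>2 = r * norm (\<mu> n)"
          by (simp add: power2_eq_square)
        finally show ?thesis .
      qed
      have "norm (exp (- z * l) * indicator (\<Delta> n) l) \<le> exp (r - r * norm (\<mu> n))" for l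
      proof (cases "l \<in> \<Delta> n")
        case True
        then have "norm (\<mu> n - l) \<le> 1" by (simp add: \<Delta>_def dist_norm)
        then have "norm (z * (\<mu> n - l)) \<le> r" using nz r(1) by (simp add: norm_mult)
        then have "Re (z * (\<mu> n - l)) \<le> r" using complex_Re_le_cmod order_trans by blast
        then have "r * norm (\<mu> n) - Re (z * l) \<le> r" using zl by (simp add: right_diff_distrib)
        then show ?thesis using True by simp
      qed simp
      then have w_le: "norm (calc (\<lambda>l. exp (- z * l) * indicator (\<Delta> n) l) (v n z)) \<le> K * exp (r - r * norm (\<mu> n)) * norm (v n z)"
        by (intro calc_norm bb)
      (* undoing the exponential bounds v n z from below *)
      have w_eq: "calc (\<lambda>l. exp (- z * l) * indicator (\<Delta> n) l) (v n z) = w n"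
      proof -
        have "calc (\<lambda>l. exp (- z * l) * indicator (\<Delta> n) l) (v n z)
            = calc (\<lambda>l. (exp (- z * l) * indicator (\<Delta> n) l) * (exp (z * l) * indicator (\<Delta> n) l)) (w n)"
          unfolding v_def by (rule calc_mult[OF bb bb, symmetric])
        also have "(\<lambda>l. (exp (- z * l) * indicator (\<Delta> n) l) * (exp (z * l) * indicator (\<Delta> n) l)) = indicator (\<Delta> n)"
          by (auto simp: fun_eq_iff indicator_def exp_add[symmetric])
        finally show ?thesis by (simp add: calc_indicator[OF \<Delta>B] Ew)
      qed
      have v_le: "norm (v n z) \<le> K * b"
      proof -
        have zc: "z \<in> cball 0 r" using nz by simp
        have "norm (v n z) = norm (calc (indicator (\<Delta> n)) (Y z))"
          using EY[OF subsetD[OF r(2) zc], of n] by (simp add: calc_indicator[OF \<Delta>B])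
        also have "\<dots> \<le> K * 1 * norm (Y z)" by (rule calc_norm[OF ib]) (simp add: indicator_def)
        also have "\<dots> \<le> K * b" using b[OF zc] K_pos by simp
        finally show ?thesis .
      qed
      have "exp (- real n * a n) \<le> K * exp (r - r * norm (\<mu> n)) * norm (v n z)"
        using w_le unfolding w_eq nw .
      also have "\<dots> \<le> K * exp (r - r * norm (\<mu> n)) * (K * b)"
        using v_le K_pos by (intro mult_left_mono) auto
      finally have "exp (r * norm (\<mu> n)) * exp (- real n * a n) \<le> exp (r * norm (\<mu> n)) * (K * exp (r - r * norm (\<mu> n)) * (K * b))"
        by (intro mult_left_mono) auto
      then show ?thesis by (simp add: exp_diff exp_minus field_simps)
    qed
    (* r * n \<ge> 2 makes r n^2 a - n a at least n a, where a = a n *)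
    obtain n :: nat where n: "real n > max (K * exp r * (K * b)) (2 / r)" using reals_Archimedean2 by blast
    have n0: "n > 0" using n r(1) by (cases n) auto
    have rn: "r * real n \<ge> 2" using n r(1) by (simp add: field_simps)
    have "2 * (real n * a n) \<le> (r * real n) * (real n * a n)" using rn a1[of n] by (intro mult_right_mono) auto
    also have "\<dots> = r * ((real n)\<^sup>2 * a n)" by (simp add: power2_eq_square)
    also have "\<dots> \<le> r * norm (\<mu> n)" using \<mu>(2)[of n] r(1) by (intro mult_left_mono) (auto simp: a_def)
    finally have "real n * a n \<le> r * norm (\<mu> n) - real n * a n" by simp
    moreover have "real n * 1 \<le> real n * a n" using a1[of n] by (intro mult_left_mono) auto
    ultimately have "real n \<le> r * norm (\<mu> n) - real n * a n" by simp
    then have "real n \<le> exp (r * norm (\<mu> n) - real n * a n)"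
      using exp_ge_add_one_self[of "r * norm (\<mu> n) - real n * a n"] by linarith
    then show False using main[OF n0] n by simp
  qed
  then show ?thesis using ws by blast
qed

end

theorem proposition5p1:
  fixes D :: "'a::complex_banach set" and A :: "'a \<Rightarrow> 'a"
  assumes "scalar_type_spectral_operator D A"
    and "\<And>y. weak_solution D A y \<Longrightarrow> analytically_continuable_at_0 y"
  shows "\<forall>y. weak_solution D A y \<longrightarrow> entire_vector_function y"
proof -
  obtain E where E: "spectral_measure E" "spectral_support E = op_spectrum D A"
    "D = {f. convergent (\<lambda>n. truncated_spectral_integral E (op_spectrum D A) n f)}"
    "\<forall>f\<in>D. (\<lambda>n. truncated_spectral_integral E (op_spectrum D A) n f) \<longlonglongrightarrow> A f"
    "closure D = UNIV"
    using assms(1) unfolding scalar_type_spectral_operator_def by blast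
  interpret scalar_operator E D A
    using E by unfold_locales auto
  have "\<exists>C\<ge>0. \<forall>l\<in>supp. norm l \<le> C * (1 + max 0 (Re l))"
    using exists_noncontinuable_weak_solution assms(2) by (meson not_le)
  then show ?thesis using entire_of_spectral_growth by blast
qed

end
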